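(* Let $n\ge 3$ and $m\ge 2n$. Then $\overline{G\cdot\mathsf p}\subset Q$ is not normal.
   Context: All varieties are over $\mathbb C$. Let $\mathfrak v$ be a complex vector space of dimension $m$ with basis $e_1,\dots,e_m$, $E=\operatorname{End}\mathfrak v$ (identified with $m\times m$ matrices $X=(x_{i,j})$ using the basis), $G=\operatorname{GL}(E)$, and $Q=S^m(E^* )$, the space of homogeneous polynomial functions of degree $m$ on $E$, on which $G$ acts by $(g\cdot q)(X)=q(g^{-1}X)$. Define $\mathsf p\in Q$ by $\mathsf p(X)=x_{1,1}^{m-n}\operatorname{perm}(X^o)$, where $X^o=(x_{i,j})_{m-n+1\le i,j\le m}$ is the lower right $n\times n$ block of $X$ and $\operatorname{perm}$ is the permanent. $\overline{G\cdot\mathsf p}$ is the Zariski closure of the orbit in $Q$, with its reduced structure. *)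

theory Defs
  imports
    "HOL-Analysis.Analysis"
    "HOL-Library.Function_Algebras"
    "HOL-Algebra.Polynomials"
begin

section \<open>Integrally closed domains\<close>

definition frac_rel :: "('a, 'b) ring_scheme \<Rightarrow> (('a \<times> 'a) \<times> ('a \<times> 'a)) set" where
  "frac_rel R = {((a, b), (c, d)).
     a \<in> carrier R \<and> b \<in> carrier R - {\<zero>\<^bsub>R\<^esub>} \<and> c \<in> carrier R \<and> d \<in> carrier R - {\<zero>\<^bsub>R\<^esub>} \<and>
     a \<otimes>\<^bsub>R\<^esub> d = c \<otimes>\<^bsub>R\<^esub> b}"

definition fraction :: "('a, 'b) ring_scheme \<Rightarrow> 'a \<Rightarrow> 'a \<Rightarrow> ('a \<times> 'a) set" where
  "fraction R a b = frac_rel R `` {(a, b)}"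

definition Frac :: "('a, 'b) ring_scheme \<Rightarrow> ('a \<times> 'a) set ring" where
  "Frac R =
     \<lparr> carrier = (carrier R \<times> (carrier R - {\<zero>\<^bsub>R\<^esub>})) // frac_rel R,
       mult = (\<lambda>x y. \<Union>(a, b)\<in>x. \<Union>(c, d)\<in>y. fraction R (a \<otimes>\<^bsub>R\<^esub> c) (b \<otimes>\<^bsub>R\<^esub> d)),
       one = fraction R \<one>\<^bsub>R\<^esub> \<one>\<^bsub>R\<^esub>,
       zero = fraction R \<zero>\<^bsub>R\<^esub> \<one>\<^bsub>R\<^esub>,
       add = (\<lambda>x y. \<Union>(a, b)\<in>x. \<Union>(c, d)\<in>y.
                fraction R (a \<otimes>\<^bsub>R\<^esub> d \<oplus>\<^bsub>R\<^esub> c \<otimes>\<^bsub>R\<^esub> b) (b \<otimes>\<^bsub>R\<^esub> d)) \<rparr>"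

text \<open>Polynomials of HOL-Algebra are coefficient lists with the leading coefficient first.\<close>

definition integral_over :: "('a, 'b) ring_scheme \<Rightarrow> 'a set \<Rightarrow> 'a \<Rightarrow> bool" where
  "integral_over K A x \<longleftrightarrow>
     (\<exists>p. polynomial\<^bsub>K\<^esub> A p \<and> p \<noteq> [] \<and> hd p = \<one>\<^bsub>K\<^esub> \<and> ring.eval K p x = \<zero>\<^bsub>K\<^esub>)"

definition integrally_closed_domain :: "('a, 'b) ring_scheme \<Rightarrow> bool" where
  "integrally_closed_domain R \<longleftrightarrow> domain R \<and>
     (\<forall>x\<in>carrier (Frac R).
        integral_over (Frac R) ((\<lambda>a. fraction R a \<one>\<^bsub>R\<^esub>) ` carrier R) x \<longrightarrow>
        x \<in> (\<lambda>a. fraction R a \<one>\<^bsub>R\<^esub>) ` carrier R)"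

context domain
begin

lemma frac_eq_trans:
  assumes "a \<in> carrier R" "c \<in> carrier R" "e \<in> carrier R"
    and "b \<in> carrier R" "d \<in> carrier R - {\<zero>}" "f \<in> carrier R"
    and ad: "a \<otimes> d = c \<otimes> b" and cf: "c \<otimes> f = e \<otimes> d"
  shows "a \<otimes> f = e \<otimes> b"
proof -
  have "d \<otimes> (a \<otimes> f) = (a \<otimes> d) \<otimes> f" using assms(1-6) by (simp add: m_ac)
  also have "\<dots> = (c \<otimes> b) \<otimes> f" by (simp only: ad)
  also have "\<dots> = (c \<otimes> f) \<otimes> b" using assms(1-6) by (simp add: m_ac)
  also have "\<dots> = (e \<otimes> d) \<otimes> b" by (simp only: cf)
  also have "\<dots> = d \<otimes> (e \<otimes> b)" using assms(1-6) by (simp add: m_ac)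
  finally show ?thesis using assms m_lcancel[of d "a \<otimes> f" "e \<otimes> b"] by auto
qed

lemma equiv_frac_rel: "equiv (carrier R \<times> (carrier R - {\<zero>})) (frac_rel R)"
proof (rule equivI)
  show "frac_rel R \<subseteq> (carrier R \<times> (carrier R - {\<zero>})) \<times> (carrier R \<times> (carrier R - {\<zero>}))"
    by (auto simp: frac_rel_def)
  show "refl_on (carrier R \<times> (carrier R - {\<zero>})) (frac_rel R)"
    by (auto simp: refl_on_def frac_rel_def)
  show "sym (frac_rel R)"
    by (auto simp: sym_def frac_rel_def)
  show "trans (frac_rel R)"
    unfolding trans_def frac_rel_def by (auto intro: frac_eq_trans)
qed

lemma fraction_eq_iff:
  assumes "a \<in> carrier R" "b \<in> carrier R - {\<zero>}" "c \<in> carrier R" "d \<in> carrier R - {\<zero>}"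
  shows "fraction R a b = fraction R c d \<longleftrightarrow> a \<otimes> d = c \<otimes> b"
  unfolding fraction_def
  using eq_equiv_class_iff[OF equiv_frac_rel, of "(a, b)" "(c, d)"] assms
  by (auto simp: frac_rel_def)

lemma fraction_in_Frac:
  "a \<in> carrier R \<Longrightarrow> b \<in> carrier R - {\<zero>} \<Longrightarrow> fraction R a b \<in> carrier (Frac R)"
  by (auto simp: Frac_def fraction_def intro!: quotientI)

lemma Frac_cases:
  assumes "x \<in> carrier (Frac R)"
  obtains a b where "a \<in> carrier R" "b \<in> carrier R - {\<zero>}" "x = fraction R a b"
  using assms by (auto simp: Frac_def fraction_def elim!: quotientE)

lemma UN2_fraction:
  assumes "a \<in> carrier R" "b \<in> carrier R - {\<zero>}" "c \<in> carrier R" "d \<in> carrier R - {\<zero>}"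
    and cong: "\<And>a' b' c' d'. \<lbrakk>a' \<in> carrier R; b' \<in> carrier R - {\<zero>}; c' \<in> carrier R;
      d' \<in> carrier R - {\<zero>}; a \<otimes> b' = a' \<otimes> b; c \<otimes> d' = c' \<otimes> d\<rbrakk> \<Longrightarrow> h a' b' c' d' = h a b c d"
  shows "(\<Union>(a', b')\<in>fraction R a b. \<Union>(c', d')\<in>fraction R c d. h a' b' c' d') = h a b c d"
proof -
  have eq: "h a' b' c' d' = h a b c d"
    if "(a', b') \<in> fraction R a b" "(c', d') \<in> fraction R c d" for a' b' c' d'
    using that by (intro cong) (auto simp: fraction_def frac_rel_def)
  have "(a, b) \<in> fraction R a b" "(c, d) \<in> fraction R c d"
    using assms(1-4) by (auto simp: fraction_def frac_rel_def)
  then show ?thesis using eq by fast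
qed

lemma Frac_mult:
  assumes "a \<in> carrier R" "b \<in> carrier R - {\<zero>}" "c \<in> carrier R" "d \<in> carrier R - {\<zero>}"
  shows "fraction R a b \<otimes>\<^bsub>Frac R\<^esub> fraction R c d = fraction R (a \<otimes> c) (b \<otimes> d)"
proof -
  have "(\<Union>(a', b')\<in>fraction R a b. \<Union>(c', d')\<in>fraction R c d. fraction R (a' \<otimes> c') (b' \<otimes> d'))
      = fraction R (a \<otimes> c) (b \<otimes> d)"
  proof (rule UN2_fraction[OF assms, where h = "\<lambda>a b c d. fraction R (a \<otimes> c) (b \<otimes> d)"])
    fix a' b' c' d'
    assume h: "a' \<in> carrier R" "b' \<in> carrier R - {\<zero>}" "c' \<in> carrier R" "d' \<in> carrier R - {\<zero>}"
      "a \<otimes> b' = a' \<otimes> b" "c \<otimes> d' = c' \<otimes> d"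
    have "(a' \<otimes> c') \<otimes> (b \<otimes> d) = (a' \<otimes> b) \<otimes> (c' \<otimes> d)" using h(1-4) assms by (simp add: m_ac)
    also have "\<dots> = (a \<otimes> b') \<otimes> (c \<otimes> d')" using h by simp
    also have "\<dots> = (a \<otimes> c) \<otimes> (b' \<otimes> d')" using h(1-4) assms by (simp add: m_ac)
    finally show "fraction R (a' \<otimes> c') (b' \<otimes> d') = fraction R (a \<otimes> c) (b \<otimes> d)"
      using h(1-4) assms by (subst fraction_eq_iff) (auto simp: integral_iff)
  qed
  then show ?thesis by (simp add: Frac_def)
qed

lemma Frac_add:
  assumes "a \<in> carrier R" "b \<in> carrier R - {\<zero>}" "c \<in> carrier R" "d \<in> carrier R - {\<zero>}"
  shows "fraction R a b \<oplus>\<^bsub>Frac R\<^esub> fraction R c d = fraction R (a \<otimes> d \<oplus> c \<otimes> b) (b \<otimes> d)"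
proof -
  have "(\<Union>(a', b')\<in>fraction R a b. \<Union>(c', d')\<in>fraction R c d.
          fraction R (a' \<otimes> d' \<oplus> c' \<otimes> b') (b' \<otimes> d'))
      = fraction R (a \<otimes> d \<oplus> c \<otimes> b) (b \<otimes> d)"
  proof (rule UN2_fraction[OF assms, where h = "\<lambda>a b c d. fraction R (a \<otimes> d \<oplus> c \<otimes> b) (b \<otimes> d)"])
    fix a' b' c' d'
    assume h: "a' \<in> carrier R" "b' \<in> carrier R - {\<zero>}" "c' \<in> carrier R" "d' \<in> carrier R - {\<zero>}"
      "a \<otimes> b' = a' \<otimes> b" "c \<otimes> d' = c' \<otimes> d"
    have "(a' \<otimes> d' \<oplus> c' \<otimes> b') \<otimes> (b \<otimes> d)
        = (a' \<otimes> b) \<otimes> (d \<otimes> d') \<oplus> (c' \<otimes> d) \<otimes> (b \<otimes> b')"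
      using h(1-4) assms by (simp add: m_ac l_distr r_distr)
    also have "\<dots> = (a \<otimes> b') \<otimes> (d \<otimes> d') \<oplus> (c \<otimes> d') \<otimes> (b \<otimes> b')" using h by simp
    also have "\<dots> = (a \<otimes> d \<oplus> c \<otimes> b) \<otimes> (b' \<otimes> d')"
      using h(1-4) assms by (simp add: m_ac l_distr r_distr)
    finally show "fraction R (a' \<otimes> d' \<oplus> c' \<otimes> b') (b' \<otimes> d') =
        fraction R (a \<otimes> d \<oplus> c \<otimes> b) (b \<otimes> d)"
      using h(1-4) assms by (subst fraction_eq_iff) (auto simp: integral_iff)
  qed
  then show ?thesis by (simp add: Frac_def)
qed

lemma Frac_zero: "\<zero>\<^bsub>Frac R\<^esub> = fraction R \<zero> \<one>" and Frac_one: "\<one>\<^bsub>Frac R\<^esub> = fraction R \<one> \<one>"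
  by (simp_all add: Frac_def)

lemma field_Frac: "field (Frac R)"
proof -
  note ops = Frac_mult Frac_add Frac_zero Frac_one fraction_eq_iff integral_iff fraction_in_Frac
  interpret F: cring "Frac R"
  proof (rule cringI)
    show "abelian_group (Frac R)"
    proof (rule abelian_groupI)
      fix x y assume "x \<in> carrier (Frac R)" "y \<in> carrier (Frac R)"
      then show "x \<oplus>\<^bsub>Frac R\<^esub> y \<in> carrier (Frac R)"
        by (elim Frac_cases) (simp add: ops)
    next
      show "\<zero>\<^bsub>Frac R\<^esub> \<in> carrier (Frac R)" by (simp add: ops)
    next
      fix x y z assume "x \<in> carrier (Frac R)" "y \<in> carrier (Frac R)" "z \<in> carrier (Frac R)"
      then show "x \<oplus>\<^bsub>Frac R\<^esub> y \<oplus>\<^bsub>Frac R\<^esub> z = x \<oplus>\<^bsub>Frac R\<^esub> (y \<oplus>\<^bsub>Frac R\<^esub> z)"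
        by (elim Frac_cases) (simp add: ops m_ac l_distr r_distr a_ac)
    next
      fix x y assume "x \<in> carrier (Frac R)" "y \<in> carrier (Frac R)"
      then show "x \<oplus>\<^bsub>Frac R\<^esub> y = y \<oplus>\<^bsub>Frac R\<^esub> x"
        by (elim Frac_cases) (simp add: ops m_ac a_ac)
    next
      fix x assume "x \<in> carrier (Frac R)"
      then show "\<zero>\<^bsub>Frac R\<^esub> \<oplus>\<^bsub>Frac R\<^esub> x = x"
        by (elim Frac_cases) (simp add: ops)
    next
      fix x assume "x \<in> carrier (Frac R)"
      then obtain a b where x: "a \<in> carrier R" "b \<in> carrier R - {\<zero>}" "x = fraction R a b"
        by (rule Frac_cases)
      have "\<ominus> a \<otimes> b \<oplus> a \<otimes> b = \<zero>" using x by (simp add: l_minus l_neg)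
      then have "fraction R (\<ominus> a) b \<oplus>\<^bsub>Frac R\<^esub> x = \<zero>\<^bsub>Frac R\<^esub>" using x by (simp add: ops)
      then show "\<exists>y\<in>carrier (Frac R). y \<oplus>\<^bsub>Frac R\<^esub> x = \<zero>\<^bsub>Frac R\<^esub>"
        using x fraction_in_Frac[of "\<ominus> a" b] by blast
    qed
    show "Group.comm_monoid (Frac R)"
    proof (rule comm_monoidI)
      fix x y assume "x \<in> carrier (Frac R)" "y \<in> carrier (Frac R)"
      then show "x \<otimes>\<^bsub>Frac R\<^esub> y \<in> carrier (Frac R)"
        by (elim Frac_cases) (simp add: ops)
    next
      show "\<one>\<^bsub>Frac R\<^esub> \<in> carrier (Frac R)" by (simp add: ops)
    next
      fix x y z assume "x \<in> carrier (Frac R)" "y \<in> carrier (Frac R)" "z \<in> carrier (Frac R)"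
      then show "x \<otimes>\<^bsub>Frac R\<^esub> y \<otimes>\<^bsub>Frac R\<^esub> z = x \<otimes>\<^bsub>Frac R\<^esub> (y \<otimes>\<^bsub>Frac R\<^esub> z)"
        by (elim Frac_cases) (simp add: ops m_ac)
    next
      fix x assume "x \<in> carrier (Frac R)"
      then show "\<one>\<^bsub>Frac R\<^esub> \<otimes>\<^bsub>Frac R\<^esub> x = x"
        by (elim Frac_cases) (simp add: ops)
    next
      fix x y assume "x \<in> carrier (Frac R)" "y \<in> carrier (Frac R)"
      then show "x \<otimes>\<^bsub>Frac R\<^esub> y = y \<otimes>\<^bsub>Frac R\<^esub> x"
        by (elim Frac_cases) (simp add: ops m_ac)
    qed
  next
    fix x y z assume "x \<in> carrier (Frac R)" "y \<in> carrier (Frac R)" "z \<in> carrier (Frac R)"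
    then show "(x \<oplus>\<^bsub>Frac R\<^esub> y) \<otimes>\<^bsub>Frac R\<^esub> z = x \<otimes>\<^bsub>Frac R\<^esub> z \<oplus>\<^bsub>Frac R\<^esub> y \<otimes>\<^bsub>Frac R\<^esub> z"
      by (elim Frac_cases) (simp add: ops m_ac l_distr r_distr)
  qed
  show ?thesis
  proof (rule F.cring_fieldI2)
    show "\<zero>\<^bsub>Frac R\<^esub> \<noteq> \<one>\<^bsub>Frac R\<^esub>" by (simp add: ops)
  next
    fix x assume x: "x \<in> carrier (Frac R)" "x \<noteq> \<zero>\<^bsub>Frac R\<^esub>"
    then obtain a b where ab: "a \<in> carrier R" "b \<in> carrier R - {\<zero>}" "x = fraction R a b"
      by (blast elim: Frac_cases)
    have "a \<noteq> \<zero>" using x(2) ab by (auto simp: ops)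
    then have "x \<otimes>\<^bsub>Frac R\<^esub> fraction R b a = \<one>\<^bsub>Frac R\<^esub>" "fraction R b a \<in> carrier (Frac R)"
      using ab by (simp_all add: ops m_comm)
    then show "\<exists>y\<in>carrier (Frac R). x \<otimes>\<^bsub>Frac R\<^esub> y = \<one>\<^bsub>Frac R\<^esub>" by blast
  qed
qed

end


section \<open>Closed subvarieties of a complex vector space\<close>

text \<open>The vector space is a subspace \<open>V\<close> of a type, with scalar multiplication \<open>s\<close>.
  Polynomial functions on \<open>V\<close> are the functions generated by the constants and the linear forms;
  only their values on \<open>V\<close> matter.\<close>

definition linear_form_on ::
  "(complex \<Rightarrow> 'v \<Rightarrow> 'v) \<Rightarrow> 'v::ab_group_add set \<Rightarrow> ('v \<Rightarrow> complex) \<Rightarrow> bool" where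
  "linear_form_on s V f \<longleftrightarrow>
     (\<forall>x\<in>V. \<forall>y\<in>V. f (x + y) = f x + f y) \<and> (\<forall>c. \<forall>x\<in>V. f (s c x) = c * f x)"

inductive_set poly_funs ::
  "(complex \<Rightarrow> 'v \<Rightarrow> 'v) \<Rightarrow> 'v::ab_group_add set \<Rightarrow> ('v \<Rightarrow> complex) set"
  for s V where
    const: "(\<lambda>_. c) \<in> poly_funs s V"
  | linear: "linear_form_on s V f \<Longrightarrow> f \<in> poly_funs s V"
  | add: "f \<in> poly_funs s V \<Longrightarrow> g \<in> poly_funs s V \<Longrightarrow> (\<lambda>x. f x + g x) \<in> poly_funs s V"
  | mult: "f \<in> poly_funs s V \<Longrightarrow> g \<in> poly_funs s V \<Longrightarrow> (\<lambda>x. f x * g x) \<in> poly_funs s V"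

definition zariski_closed ::
  "(complex \<Rightarrow> 'v \<Rightarrow> 'v) \<Rightarrow> 'v::ab_group_add set \<Rightarrow> 'v set \<Rightarrow> bool" where
  "zariski_closed s V Z \<longleftrightarrow> (\<exists>P \<subseteq> poly_funs s V. Z = {x \<in> V. \<forall>f\<in>P. f x = 0})"

definition zariski_closure ::
  "(complex \<Rightarrow> 'v \<Rightarrow> 'v) \<Rightarrow> 'v::ab_group_add set \<Rightarrow> 'v set \<Rightarrow> 'v set" where
  "zariski_closure s V S = zariski_closed s V hull S"

text \<open>The coordinate ring of \<open>Z\<close> with its reduced structure: restrictions to \<open>Z\<close> of polynomial
  functions on \<open>V\<close>.\<close>

definition coordinate_ring ::
  "(complex \<Rightarrow> 'v \<Rightarrow> 'v) \<Rightarrow> 'v::ab_group_add set \<Rightarrow> 'v set \<Rightarrow> ('v \<Rightarrow> complex) ring" where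
  "coordinate_ring s V Z =
     \<lparr> carrier = (\<lambda>f. restrict f Z) ` poly_funs s V,
       mult = (\<lambda>f g. \<lambda>x\<in>Z. f x * g x),
       one = (\<lambda>x\<in>Z. 1),
       zero = (\<lambda>x\<in>Z. 0),
       add = (\<lambda>f g. \<lambda>x\<in>Z. f x + g x) \<rparr>"

definition normal_variety ::
  "(complex \<Rightarrow> 'v \<Rightarrow> 'v) \<Rightarrow> 'v::ab_group_add set \<Rightarrow> 'v set \<Rightarrow> bool" where
  "normal_variety s V Z \<longleftrightarrow> integrally_closed_domain (coordinate_ring s V Z)"

lemma zariski_closure_eq:
  assumes "S \<subseteq> V"
  shows "zariski_closure s V S =
    {x \<in> V. \<forall>f\<in>poly_funs s V. (\<forall>y\<in>S. f y = 0) \<longrightarrow> f x = 0}" (is "_ = ?C")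
proof
  have "?C = {x \<in> V. \<forall>f\<in>{f \<in> poly_funs s V. \<forall>y\<in>S. f y = 0}. f x = 0}" by auto
  then have "zariski_closed s V ?C" unfolding zariski_closed_def by blast
  then show "zariski_closure s V S \<subseteq> ?C"
    unfolding zariski_closure_def using assms by (intro hull_minimal) auto
  show "?C \<subseteq> zariski_closure s V S"
    unfolding zariski_closure_def hull_def zariski_closed_def by blast
qed

lemma coordinate_ring_cring: "cring (coordinate_ring s V Z)"
proof (rule cringI)
  let ?R = "coordinate_ring s V Z"
  have const: "(\<lambda>x\<in>Z. c) \<in> carrier ?R" for c
    using poly_funs.const by (auto simp: coordinate_ring_def)
  have closed: "(\<lambda>x\<in>Z. f x + g x) \<in> carrier ?R" "(\<lambda>x\<in>Z. f x * g x) \<in> carrier ?R"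
    if fg: "f \<in> carrier ?R" "g \<in> carrier ?R" for f g
  proof -
    obtain f' g' where *: "f' \<in> poly_funs s V" "g' \<in> poly_funs s V"
      "f = restrict f' Z" "g = restrict g' Z"
      using fg by (auto simp: coordinate_ring_def)
    have "(\<lambda>x\<in>Z. f x + g x) = (\<lambda>x\<in>Z. f' x + g' x)"
      "(\<lambda>x\<in>Z. f x * g x) = (\<lambda>x\<in>Z. f' x * g' x)"
      by (auto simp: * fun_eq_iff)
    then show "(\<lambda>x\<in>Z. f x + g x) \<in> carrier ?R" "(\<lambda>x\<in>Z. f x * g x) \<in> carrier ?R"
      using poly_funs.add[OF *(1,2)] poly_funs.mult[OF *(1,2)] by (auto simp: coordinate_ring_def)
  qed
  have ext: "f \<in> extensional Z" if "f \<in> carrier ?R" for f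
    using that by (auto simp: coordinate_ring_def)
  have id: "(\<lambda>x\<in>Z. f x) = f" if "f \<in> carrier ?R" for f
    using ext[OF that] by (rule extensional_restrict)
  have ops: "f \<oplus>\<^bsub>?R\<^esub> g = (\<lambda>x\<in>Z. f x + g x)" "f \<otimes>\<^bsub>?R\<^esub> g = (\<lambda>x\<in>Z. f x * g x)"
    "\<one>\<^bsub>?R\<^esub> = (\<lambda>x\<in>Z. 1)" "\<zero>\<^bsub>?R\<^esub> = (\<lambda>x\<in>Z. 0)" for f g
    by (simp_all add: coordinate_ring_def)
  show "abelian_group ?R"
  proof (rule abelian_groupI)
    fix f assume f: "f \<in> carrier ?R"
    have "(\<lambda>x\<in>Z. (\<lambda>x\<in>Z. -1) x * f x) \<oplus>\<^bsub>?R\<^esub> f = \<zero>\<^bsub>?R\<^esub>"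
      by (auto simp: ops fun_eq_iff)
    then show "\<exists>g\<in>carrier ?R. g \<oplus>\<^bsub>?R\<^esub> f = \<zero>\<^bsub>?R\<^esub>"
      using closed(2)[OF const f] by blast
  qed (auto simp: ops closed const id algebra_simps cong: restrict_cong)
  show "Group.comm_monoid ?R"
    by (rule comm_monoidI) (auto simp: ops closed const id algebra_simps cong: restrict_cong)
  show "(f \<oplus>\<^bsub>?R\<^esub> g) \<otimes>\<^bsub>?R\<^esub> h = f \<otimes>\<^bsub>?R\<^esub> h \<oplus>\<^bsub>?R\<^esub> g \<otimes>\<^bsub>?R\<^esub> h" for f g h
    by (auto simp: ops algebra_simps cong: restrict_cong)
qed


section \<open>The representation of \<open>GL(E)\<close> on \<open>Q\<close>, and the padded permanent\<close>

text \<open>\<open>E\<close> is \<open>complex^'m^'m\<close>, on which the library's \<open>*\<^sub>R\<close> has real scalars and \<open>*s\<close> has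
  scalars in \<open>complex^'m\<close>.\<close>

definition mscale :: "complex \<Rightarrow> complex^'m^'m \<Rightarrow> complex^'m^'m" where
  "mscale c A = (\<chi> i j. c * A $ i $ j)"

definition fscale :: "complex \<Rightarrow> ('a \<Rightarrow> complex) \<Rightarrow> 'a \<Rightarrow> complex" where
  "fscale c q = (\<lambda>x. c * q x)"

definition GL :: "(complex^'m^'m \<Rightarrow> complex^'m^'m) set" where
  "GL = {g. Vector_Spaces.linear mscale mscale g \<and> bij g}"

definition act ::
  "(complex^'m^'m \<Rightarrow> complex^'m^'m) \<Rightarrow> (complex^'m^'m \<Rightarrow> complex) \<Rightarrow> complex^'m^'m \<Rightarrow> complex" where
  "act g q = (\<lambda>A. q (inv_into UNIV g A))"

definition homog_polys :: "nat \<Rightarrow> (complex^'m^'m::finite \<Rightarrow> complex) set" where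
  "homog_polys d =
     {q. \<exists>c. \<forall>A. q A = (\<Sum>\<alpha> | (\<Sum>i\<in>UNIV. \<Sum>j\<in>UNIV. \<alpha> i j) = d.
                          c \<alpha> * (\<Prod>i\<in>UNIV. \<Prod>j\<in>UNIV. A $ i $ j ^ \<alpha> i j))}"

definition permanent_on :: "'i set \<Rightarrow> ('i \<Rightarrow> 'i \<Rightarrow> complex) \<Rightarrow> complex" where
  "permanent_on I M = (\<Sum>\<sigma> | \<sigma> permutes I. \<Prod>i\<in>I. M i (\<sigma> i))"

text \<open>The function \<open>e\<close> enumerates the basis, so that \<open>A $ e i $ e j\<close> is the coordinate
  \<open>x\<^sub>i\<^sub>j\<close> for \<open>1 \<le> i, j \<le> m\<close>.\<close>

definition padded_perm :: "(nat \<Rightarrow> 'm::finite) \<Rightarrow> nat \<Rightarrow> complex^'m^'m \<Rightarrow> complex" where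
  "padded_perm e n A =
     (A $ e 1 $ e 1) ^ (CARD('m) - n) *
     permanent_on {CARD('m) - n + 1..CARD('m)} (\<lambda>i j. A $ e i $ e j)"

definition orbit_closure ::
  "(complex^'m^'m::finite \<Rightarrow> complex) \<Rightarrow> (complex^'m^'m \<Rightarrow> complex) set" where
  "orbit_closure q = zariski_closure fscale (homog_polys CARD('m)) ((\<lambda>g. act g q) ` GL)"


subsection \<open>The orbit lies in \<open>Q\<close>\<close>

abbreviation exps :: "nat \<Rightarrow> ('m::finite \<Rightarrow> 'm \<Rightarrow> nat) set" where
  "exps d \<equiv> {\<alpha>. (\<Sum>i\<in>UNIV. \<Sum>j\<in>UNIV. \<alpha> i j) = d}"

abbreviation mon :: "('m::finite \<Rightarrow> 'm \<Rightarrow> nat) \<Rightarrow> complex^'m^'m \<Rightarrow> complex" where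
  "mon \<alpha> A \<equiv> (\<Prod>i\<in>UNIV. \<Prod>j\<in>UNIV. A $ i $ j ^ \<alpha> i j)"

lemma finite_exps: "finite (exps d :: ('m::finite \<Rightarrow> 'm \<Rightarrow> nat) set)"
proof -
  have "\<alpha> i j \<le> d" if "\<alpha> \<in> exps d" for \<alpha> :: "'m \<Rightarrow> 'm \<Rightarrow> nat" and i j
  proof -
    have "\<alpha> i j \<le> (\<Sum>j\<in>UNIV. \<alpha> i j)" by (rule member_le_sum) auto
    also have "\<dots> \<le> (\<Sum>i\<in>UNIV. \<Sum>j\<in>UNIV. \<alpha> i j)"
      by (rule member_le_sum[where f = "\<lambda>i. \<Sum>j\<in>UNIV. \<alpha> i j"]) auto
    finally show ?thesis using that by simp
  qed
  then have "exps d \<subseteq> (PiE UNIV (\<lambda>_. PiE UNIV (\<lambda>_. {..d})) :: ('m \<Rightarrow> 'm \<Rightarrow> nat) set)"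
    by (auto simp: PiE_def)
  then show ?thesis
    by (rule finite_subset) (intro finite_PiE; simp)
qed

lemma homog_polysI: "(\<And>A. q A = (\<Sum>\<alpha>\<in>exps d. c \<alpha> * mon \<alpha> A)) \<Longrightarrow> q \<in> homog_polys d"
  unfolding homog_polys_def by blast

lemma homog_polysD: "q \<in> homog_polys d \<Longrightarrow> \<exists>c. \<forall>A. q A = (\<Sum>\<alpha>\<in>exps d. c \<alpha> * mon \<alpha> A)"
  unfolding homog_polys_def by blast

lemma homog_polys_zero: "(\<lambda>_. 0) \<in> homog_polys d"
  by (rule homog_polysI[where c = "\<lambda>_. 0"]) simp

lemma homog_polys_scale:
  assumes "q \<in> homog_polys d"
  shows "(\<lambda>A. k * q A) \<in> homog_polys d"
proof -
  obtain c where "\<And>A. q A = (\<Sum>\<alpha>\<in>exps d. c \<alpha> * mon \<alpha> A)" using homog_polysD[OF assms] by blast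
  then show ?thesis
    by (intro homog_polysI[where c = "\<lambda>\<alpha>. k * c \<alpha>"]) (simp add: sum_distrib_left mult.assoc)
qed

lemma homog_polys_add:
  assumes "q \<in> homog_polys d" "q' \<in> homog_polys d"
  shows "(\<lambda>A. q A + q' A) \<in> homog_polys d"
proof -
  obtain c where "\<And>A. q A = (\<Sum>\<alpha>\<in>exps d. c \<alpha> * mon \<alpha> A)" using homog_polysD[OF assms(1)] by blast
  moreover obtain c' where "\<And>A. q' A = (\<Sum>\<alpha>\<in>exps d. c' \<alpha> * mon \<alpha> A)"
    using homog_polysD[OF assms(2)] by blast
  ultimately show ?thesis
    by (intro homog_polysI[where c = "\<lambda>\<alpha>. c \<alpha> + c' \<alpha>"]) (simp add: sum.distrib distrib_right)
qed

lemma homog_polys_sum: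
  assumes "\<And>i. i \<in> I \<Longrightarrow> q i \<in> homog_polys d"
  shows "(\<lambda>A. \<Sum>i\<in>I. q i A) \<in> homog_polys d"
  using assms
  by (induction I rule: infinite_finite_induct) (auto simp: homog_polys_zero homog_polys_add)

lemma mon_in_homog_polys:
  assumes "\<alpha> \<in> exps d"
  shows "mon \<alpha> \<in> homog_polys d"
proof (rule homog_polysI[where c = "\<lambda>\<beta>. if \<beta> = \<alpha> then 1 else 0"])
  fix A
  have "(\<Sum>\<beta>\<in>exps d. (if \<beta> = \<alpha> then 1 else 0) * mon \<beta> A)
      = (\<Sum>\<beta>\<in>exps d. if \<beta> = \<alpha> then mon \<beta> A else 0)"
    by (rule sum.cong) auto
  also have "\<dots> = mon \<alpha> A" using assms by (simp only: sum.delta[OF finite_exps] if_True)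
  finally show "mon \<alpha> A = (\<Sum>\<beta>\<in>exps d. (if \<beta> = \<alpha> then 1 else 0) * mon \<beta> A)" by simp
qed

lemma homog_polys_mult:
  assumes "q \<in> homog_polys d" "q' \<in> homog_polys d'"
  shows "(\<lambda>A. q A * q' A) \<in> homog_polys (d + d')"
proof -
  obtain c where c: "\<And>A. q A = (\<Sum>\<alpha>\<in>exps d. c \<alpha> * mon \<alpha> A)" using homog_polysD[OF assms(1)] by blast
  obtain c' where c': "\<And>A. q' A = (\<Sum>\<alpha>\<in>exps d'. c' \<alpha> * mon \<alpha> A)"
    using homog_polysD[OF assms(2)] by blast
  have eq: "q A * q' A = (\<Sum>\<alpha>\<in>exps d. \<Sum>\<beta>\<in>exps d'. (c \<alpha> * c' \<beta>) * mon (\<lambda>i j. \<alpha> i j + \<beta> i j) A)"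
    for A
    unfolding c c' sum_product by (intro sum.cong refl) (simp add: power_add prod.distrib mult_ac)
  have "(\<lambda>A. (c \<alpha> * c' \<beta>) * mon (\<lambda>i j. \<alpha> i j + \<beta> i j) A) \<in> homog_polys (d + d')"
    if "\<alpha> \<in> exps d" "\<beta> \<in> exps d'" for \<alpha> \<beta>
    using that by (intro homog_polys_scale mon_in_homog_polys) (simp add: sum.distrib)
  then show ?thesis unfolding eq by (intro homog_polys_sum) auto
qed

lemma homog_polys_one: "(\<lambda>_. 1) \<in> homog_polys 0"
  using mon_in_homog_polys[of "\<lambda>_ _. 0" 0] by simp

lemma homog_polys_power:
  assumes "q \<in> homog_polys d"
  shows "(\<lambda>A. q A ^ k) \<in> homog_polys (k * d)"
  by (induction k) (auto simp: homog_polys_one intro: homog_polys_mult assms)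

lemma homog_polys_prod:
  assumes "finite I" "\<And>i. i \<in> I \<Longrightarrow> q i \<in> homog_polys (d i)"
  shows "(\<lambda>A. \<Prod>i\<in>I. q i A) \<in> homog_polys (\<Sum>i\<in>I. d i)"
  using assms by (induction I rule: finite_induct) (auto simp: homog_polys_one homog_polys_mult)

lemma homog_polys_entry: "(\<lambda>A. A $ k $ l) \<in> homog_polys 1"
proof -
  let ?\<alpha> = "\<lambda>i j. if i = k then if j = l then 1 else 0 else (0::nat)"
  have "(\<Sum>j\<in>UNIV. ?\<alpha> i j) = (if i = k then 1 else 0)" for i by simp
  then have "?\<alpha> \<in> exps 1" by simp
  then have "mon ?\<alpha> \<in> homog_polys 1" by (rule mon_in_homog_polys)
  moreover have "mon ?\<alpha> A = A $ k $ l" for A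
  proof -
    have "(\<Prod>j\<in>UNIV. A $ i $ j ^ ?\<alpha> i j) = (if i = k then A $ k $ l else 1)" for i
    proof (cases "i = k")
      case True
      have "(\<Prod>j\<in>UNIV. A $ i $ j ^ ?\<alpha> i j) = (\<Prod>j\<in>UNIV. if j = l then A $ k $ j else 1)"
        using True by (intro prod.cong) auto
      then show ?thesis using True by simp
    qed simp
    then show ?thesis by simp
  qed
  ultimately show ?thesis by simp
qed

lemma homog_polys_linear_comp:
  assumes g: "Vector_Spaces.linear mscale mscale g" and q: "q \<in> homog_polys d"
  shows "(\<lambda>A. q (g A)) \<in> homog_polys d"
proof -
  interpret Vector_Spaces.linear mscale mscale g by fact
  define u :: "'a \<Rightarrow> 'a \<Rightarrow> complex^'a^'a" where
    "u k l = (\<chi> i j. if i = k then if j = l then 1 else 0 else 0)" for k l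
  have expand: "A = (\<Sum>k\<in>UNIV. \<Sum>l\<in>UNIV. mscale (A $ k $ l) (u k l))" for A
  proof -
    have "(\<Sum>l\<in>UNIV. mscale (A $ k $ l) (u k l) $ i $ j) = (if k = i then A $ i $ j else 0)"
      for k i j
    proof -
      have "(\<Sum>l\<in>UNIV. mscale (A $ k $ l) (u k l) $ i $ j)
          = (\<Sum>l\<in>UNIV. if l = j then (if k = i then A $ k $ l else 0) else 0)"
        by (intro sum.cong) (auto simp: mscale_def u_def)
      then show ?thesis by simp
    qed
    then show ?thesis by (simp add: vec_eq_iff)
  qed
  have entry: "g A $ i $ j = (\<Sum>k\<in>UNIV. \<Sum>l\<in>UNIV. g (u k l) $ i $ j * A $ k $ l)" for A i j
  proof -
    have "g A = g (\<Sum>k\<in>UNIV. \<Sum>l\<in>UNIV. mscale (A $ k $ l) (u k l))"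
      by (rule arg_cong[OF expand])
    also have "\<dots> = (\<Sum>k\<in>UNIV. \<Sum>l\<in>UNIV. mscale (A $ k $ l) (g (u k l)))"
      by (simp only: sum scale)
    finally have "g A $ i $ j = (\<Sum>k\<in>UNIV. \<Sum>l\<in>UNIV. mscale (A $ k $ l) (g (u k l))) $ i $ j"
      by (rule arg_cong)
    also have "\<dots> = (\<Sum>k\<in>UNIV. \<Sum>l\<in>UNIV. g (u k l) $ i $ j * A $ k $ l)"
      by (simp add: mscale_def mult.commute)
    finally show ?thesis .
  qed
  have lin: "(\<lambda>A. g A $ i $ j) \<in> homog_polys 1" for i j
  proof -
    have "(\<lambda>A. \<Sum>k\<in>UNIV. \<Sum>l\<in>UNIV. g (u k l) $ i $ j * A $ k $ l) \<in> homog_polys 1"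
      by (intro homog_polys_sum homog_polys_scale homog_polys_entry)
    then show ?thesis by (simp only: entry[symmetric])
  qed
  have "(\<lambda>A. mon \<alpha> (g A)) \<in> homog_polys d" if \<alpha>: "\<alpha> \<in> exps d" for \<alpha>
  proof -
    have "(\<lambda>A. mon \<alpha> (g A)) \<in> homog_polys (\<Sum>i\<in>UNIV. \<Sum>j\<in>UNIV. \<alpha> i j * 1)"
      by (intro homog_polys_prod homog_polys_power lin) auto
    then show ?thesis using \<alpha> by simp
  qed
  moreover obtain c where "\<And>A. q A = (\<Sum>\<alpha>\<in>exps d. c \<alpha> * mon \<alpha> A)" using homog_polysD[OF q] by blast
  ultimately show ?thesis
    by (simp only:) (intro homog_polys_sum homog_polys_scale, simp)
qed

lemma act_in_homog_polys:
  assumes "g \<in> GL" "q \<in> homog_polys d"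
  shows "act g q \<in> homog_polys d"
proof -
  have lin: "Vector_Spaces.linear mscale mscale g" and bij: "bij g"
    using assms(1) by (auto simp: GL_def)
  have g: "inv_into UNIV g (g A) = A" "g (inv_into UNIV g A) = A" for A
    using bij by (auto simp: bij_is_inj bij_is_surj surj_f_inv_f)
  have "Vector_Spaces.linear mscale mscale (inv_into UNIV g)"
    unfolding Vector_Spaces.linear_iff
  proof (intro conjI allI)
    interpret Vector_Spaces.linear mscale mscale g by (rule lin)
    show "vector_space (mscale :: complex \<Rightarrow> complex^'a^'a \<Rightarrow> _)" by unfold_locales
    show "vector_space (mscale :: complex \<Rightarrow> complex^'a^'a \<Rightarrow> _)" by unfold_locales
    show "inv_into UNIV g (A + B) = inv_into UNIV g A + inv_into UNIV g B" for A B
      using g(1)[of "inv_into UNIV g A + inv_into UNIV g B"] by (simp add: add g(2))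
    show "inv_into UNIV g (mscale c A) = mscale c (inv_into UNIV g A)" for c A
      using g(1)[of "mscale c (inv_into UNIV g A)"] by (simp add: scale g(2))
  qed
  then show ?thesis unfolding act_def by (rule homog_polys_linear_comp) fact
qed

lemma padded_perm_in_homog_polys:
  fixes e :: "nat \<Rightarrow> 'm::finite"
  assumes "n \<le> CARD('m)"
  shows "padded_perm e n \<in> homog_polys CARD('m)"
proof -
  let ?I = "{CARD('m) - n + 1..CARD('m)}"
  have "(\<lambda>A :: complex^'m^'m. \<Prod>i\<in>?I. A $ e i $ e (\<sigma> i)) \<in> homog_polys (\<Sum>i\<in>?I. 1)" for \<sigma>
    by (intro homog_polys_prod homog_polys_entry) auto
  then have "(\<lambda>A. permanent_on ?I (\<lambda>i j. A $ e i $ e j)) \<in> homog_polys n"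
    unfolding permanent_on_def using assms by (intro homog_polys_sum) simp
  from homog_polys_mult[OF homog_polys_power[OF homog_polys_entry, of "e 1" "e 1" "CARD('m) - n"] this]
  show ?thesis using assms unfolding padded_perm_def by simp
qed

lemma orbit_subset_homog_polys:
  fixes e :: "nat \<Rightarrow> 'm::finite"
  assumes "n \<le> CARD('m)"
  shows "(\<lambda>g. act g (padded_perm e n)) ` GL \<subseteq> homog_polys CARD('m)"
  using assms by (auto intro: act_in_homog_polys padded_perm_in_homog_polys)

end

(* Write k = m - n.  Every point of the orbit is q = l^k h with l a linear form and h of degree n.
   Fix v, w in E.  The function F(q) = l(w)^k h(v) is a rational function of q, because l(v) : l(w)
   can be computed from q: h has degree n, so the (n+1)-st derivative of q in the direction
   l(w) v - l(v) w vanishes at every point, which gives linear equations for the monomials of degree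
   n + 1 in l(v), l(w) with coefficients linear in q.  Moreover F is integral over the coordinate
   ring: for a = l(v), b = l(w) and large D, multiplication by F maps the span of the monomials
   of degree D in a, b into itself with coefficients linear in q.

   If F were regular, its linear part would be a linear form L on Q with
   L(l^k h^n) = l(w)^k h(v)^n for linear forms l, h.  For coordinates x, y dual to v, w this gives
   L(y^k x^n) = 1 and L((y + t x)^m) = t^n for all t, hence binom(m, n) = 1. *)

theory Submission
  imports Defs
begin

hide_const (open) Polynomials.degree Polynomials.lead_coeff up_ring.coeff up_ring.monom

subsection \<open>Elimination\<close>

text \<open>Replacing (l, h) by (s l, s^(-k) h) leaves l^k h unchanged, and F is invariant under
  this, which makes it a candidate for a function of q. F is linear in the tensor of l^k and h,
  whereas a linear form on Q sees only their product. Multiplication from S^k tensor S^n to S^m has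
  a kernel, and (y + t x)^m exposes it: binom(m, n) counts the ways of dividing m equal factors into
  k for l and n for h. Two degenerations shape the proof. Where l(v) = 0 the equations for the ratio
  say nothing and the integral equation is not derived, so the denominator receives an extra factor
  that vanishes there. And the products l^k h^n of the final contradiction are reached as limits of
  points of the orbit, along curves on which the denominator can be cancelled. The bound m >= 2n
  enters as n <= k: it lets the coefficients of h along a line be recovered one after another from
  those of l^k h, and it makes the extra factor of the denominator vanish where it should.\<close>

lemma poly_funs_uminus: "f \<in> poly_funs s V \<Longrightarrow> (\<lambda>q. - f q) \<in> poly_funs s V"
  using poly_funs.mult[OF poly_funs.const[of "-1"], of f] by simp

lemma poly_funs_diff:
  "f \<in> poly_funs s V \<Longrightarrow> g \<in> poly_funs s V \<Longrightarrow> (\<lambda>q. f q - g q) \<in> poly_funs s V"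
  using poly_funs.add[OF _ poly_funs_uminus, of f s V g] by simp

lemma poly_funs_power: "f \<in> poly_funs s V \<Longrightarrow> (\<lambda>q. f q ^ k) \<in> poly_funs s V"
  by (induction k) (simp_all add: poly_funs.const poly_funs.mult)

lemma poly_funs_sum:
  "(\<And>i. i \<in> I \<Longrightarrow> f i \<in> poly_funs s V) \<Longrightarrow> (\<lambda>q. \<Sum>i\<in>I. f i q) \<in> poly_funs s V"
proof (induction I rule: infinite_finite_induct)
  case (insert i I)
  then have "(\<lambda>q. f i q + (\<Sum>i\<in>I. f i q)) \<in> poly_funs s V"
    by (intro poly_funs.add insert.IH) auto
  then show ?case using insert.hyps by simp
qed (simp_all add: poly_funs.const)

text \<open>Fraction-free elimination of \<open>\<nu> 0\<close> replaces the matrix by its 2x2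
  minors at the pivot \<open>M 0 0\<close>, so entries remain polynomial. At \<open>y\<close> the
  column below the pivot is zero, hence the minors are just rescaled and the matrix stays triangular
  with nonzero diagonal; this keeps \<open>B y\<close> nonzero. With monomials of degree n + 1 in
  two values for \<open>\<nu>\<close>, the result expresses their ratio rationally in
  \<open>q\<close>.\<close>

lemma triangular_elimination:
  fixes M :: "nat \<Rightarrow> nat \<Rightarrow> 'v::ab_group_add \<Rightarrow> complex"
  assumes "\<And>i j. i \<le> n \<Longrightarrow> j \<le> Suc n \<Longrightarrow> M i j \<in> poly_funs s V"
    and "\<And>i. i \<le> n \<Longrightarrow> M i i y \<noteq> 0"
    and "\<And>i j. i \<le> n \<Longrightarrow> j < i \<Longrightarrow> M i j y = 0"
  shows "\<exists>A\<in>poly_funs s V. \<exists>B\<in>poly_funs s V. B y \<noteq> 0 \<and>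
    (\<forall>q \<nu>. (\<forall>i\<le>n. (\<Sum>j\<le>Suc n. M i j q * \<nu> j) = 0) \<longrightarrow> B q * \<nu> n = A q * \<nu> (Suc n))"
  using assms
proof (induction n arbitrary: M)
  case 0
  have "(\<lambda>q. - M 0 1 q) \<in> poly_funs s V" "M 0 0 \<in> poly_funs s V" "M 0 0 y \<noteq> 0"
    using "0.prems" by (auto intro: poly_funs_uminus)
  then show ?case
    by (rule_tac bexI[of _ "\<lambda>q. - M 0 1 q"], rule_tac bexI[of _ "M 0 0"])
       (simp_all add: eq_neg_iff_add_eq_0)
next
  case (Suc n)
  define M' where "M' i j = (\<lambda>q. M 0 0 q * M (Suc i) (Suc j) q - M (Suc i) 0 q * M 0 (Suc j) q)" for i j
  have y: "M' i j y = M 0 0 y * M (Suc i) (Suc j) y" if "i \<le> n" for i j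
    using Suc.prems(3)[of "Suc i" 0] that by (simp add: M'_def)
  have "\<exists>A\<in>poly_funs s V. \<exists>B\<in>poly_funs s V. B y \<noteq> 0 \<and>
    (\<forall>q \<nu>. (\<forall>i\<le>n. (\<Sum>j\<le>Suc n. M' i j q * \<nu> j) = 0) \<longrightarrow> B q * \<nu> n = A q * \<nu> (Suc n))"
  proof (rule Suc.IH)
    show "M' i j \<in> poly_funs s V" if "i \<le> n" "j \<le> Suc n" for i j
      unfolding M'_def using that by (intro poly_funs_diff poly_funs.mult Suc.prems) auto
    show "M' i i y \<noteq> 0" if "i \<le> n" for i
      using that Suc.prems(2)[of "Suc i"] Suc.prems(2)[of 0] by (simp add: y)
    show "M' i j y = 0" if "i \<le> n" "j < i" for i j
      using that Suc.prems(3)[of "Suc i" "Suc j"] by (simp add: y)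
  qed
  then obtain A B where AB: "A \<in> poly_funs s V" "B \<in> poly_funs s V" "B y \<noteq> 0"
    "\<And>q \<nu>. (\<forall>i\<le>n. (\<Sum>j\<le>Suc n. M' i j q * \<nu> j) = 0) \<Longrightarrow> B q * \<nu> n = A q * \<nu> (Suc n)"
    by blast
  have key: "B q * \<nu> (Suc n) = A q * \<nu> (Suc (Suc n))"
    if h: "\<forall>i\<le>Suc n. (\<Sum>j\<le>Suc (Suc n). M i j q * \<nu> j) = 0" for q \<nu>
  proof (rule AB(4)[of q "\<lambda>j. \<nu> (Suc j)"], intro allI impI)
    fix i assume i: "i \<le> n"
    have split: "(\<Sum>j\<le>Suc (Suc n). M i j q * \<nu> j)
        = M i 0 q * \<nu> 0 + (\<Sum>j\<le>Suc n. M i (Suc j) q * \<nu> (Suc j))" for i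
      by (rule sum.atMost_Suc_shift)
    have e: "(\<Sum>j\<le>Suc n. M i (Suc j) q * \<nu> (Suc j)) = - M i 0 q * \<nu> 0" if "i \<le> Suc n" for i
      using h that unfolding split add_eq_0_iff mult_minus_left by blast
    have "(\<Sum>j\<le>Suc n. M' i j q * \<nu> (Suc j)) =
        M 0 0 q * (\<Sum>j\<le>Suc n. M (Suc i) (Suc j) q * \<nu> (Suc j))
        - M (Suc i) 0 q * (\<Sum>j\<le>Suc n. M 0 (Suc j) q * \<nu> (Suc j))"
      unfolding M'_def sum_distrib_left sum_subtractf[symmetric]
      by (intro sum.cong refl) (simp add: algebra_simps)
    also have "\<dots> = 0"
      unfolding e[OF le0] e[OF Suc_le_mono[THEN iffD2, OF i]] by simp
    finally show "(\<Sum>j\<le>Suc n. M' i j q * \<nu> (Suc j)) = 0" .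
  qed
  show ?case
    by (rule bexI[of _ A], rule bexI[of _ B], intro conjI AB(3) allI impI, rule key, assumption,
        rule AB(2), rule AB(1))
qed

text \<open>The case \<open>c = 0\<close>, meaning degree below \<open>d\<close>, is included so
  that entries on and off the diagonal of a matrix are handled by the same rules.\<close>

definition monic_upto :: "nat \<Rightarrow> complex \<Rightarrow> complex poly \<Rightarrow> bool" where
  "monic_upto d c p \<longleftrightarrow> coeff p d = c \<and> (\<forall>i>d. coeff p i = 0)"

lemma monic_upto_mult:
  assumes "monic_upto d c p" "monic_upto d' c' p'"
  shows "monic_upto (d + d') (c * c') (p * p')"
proof -
  have "coeff (p * p') N = (if N = d + d' then c * c' else 0)" if "N \<ge> d + d'" for N
  proof -
    have "coeff (p * p') N = (\<Sum>i\<le>N. if i = d \<and> N = d + d' then c * c' else 0)"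
      unfolding coeff_mult
    proof (intro sum.cong refl)
      fix i
      have "i > d \<or> i = d \<and> N = d + d' \<or> (i < d \<or> N \<noteq> d + d') \<and> N - i > d' \<and> i \<le> d"
        using that by arith
      then consider "i > d" | "i = d" "N = d + d'" | "i < d \<or> N \<noteq> d + d'" "N - i > d'" "i \<le> d"
        by blast
      then show "coeff p i * coeff p' (N - i) = (if i = d \<and> N = d + d' then c * c' else 0)"
        using assms by cases (auto simp: monic_upto_def)
    qed
    then show ?thesis using that by (auto simp: sum.delta)
  qed
  then show ?thesis by (auto simp: monic_upto_def)
qed

lemma monic_upto_diff:
  "monic_upto d c p \<Longrightarrow> monic_upto d c' p' \<Longrightarrow> monic_upto d (c - c') (p - p')"
  by (auto simp: monic_upto_def)

definition coeffs_in ::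
  "(complex \<Rightarrow> 'v \<Rightarrow> 'v) \<Rightarrow> 'v::ab_group_add set \<Rightarrow> ('v \<Rightarrow> complex poly) \<Rightarrow> bool" where
  "coeffs_in s V P \<longleftrightarrow> (\<forall>i. (\<lambda>q. coeff (P q) i) \<in> poly_funs s V)"

lemma coeffs_in_mult: "coeffs_in s V P \<Longrightarrow> coeffs_in s V P' \<Longrightarrow> coeffs_in s V (\<lambda>q. P q * P' q)"
  unfolding coeffs_in_def coeff_mult by (intro allI poly_funs_sum poly_funs.mult) auto

lemma coeffs_in_diff: "coeffs_in s V P \<Longrightarrow> coeffs_in s V P' \<Longrightarrow> coeffs_in s V (\<lambda>q. P q - P' q)"
  unfolding coeffs_in_def coeff_diff by (intro allI poly_funs_diff) auto

text \<open>Fraction-free elimination keeps the diagonal monic and of larger degree than the rest;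
  this replaces the characteristic polynomial.\<close>

lemma monic_elimination:
  fixes M :: "nat \<Rightarrow> nat \<Rightarrow> 'v::ab_group_add \<Rightarrow> complex poly"
  assumes "\<And>i j. i \<le> n \<Longrightarrow> j \<le> n \<Longrightarrow> coeffs_in s V (M i j)"
    and "\<And>i j q. i \<le> n \<Longrightarrow> j \<le> n \<Longrightarrow> monic_upto d (if i = j then 1 else 0) (M i j q)"
  shows "\<exists>P d'. coeffs_in s V P \<and> (\<forall>q. monic_upto d' 1 (P q)) \<and>
    (\<forall>q z \<nu>. (\<forall>i\<le>n. (\<Sum>j\<le>n. poly (M i j q) z * \<nu> j) = 0) \<longrightarrow> poly (P q) z * \<nu> n = 0)"
  using assms
proof (induction n arbitrary: M d)
  case 0
  have "monic_upto d 1 (M 0 0 q)" for q using "0.prems"(2)[of 0 0] by simp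
  moreover have "coeffs_in s V (M 0 0)" using "0.prems"(1) by simp
  ultimately show ?case
    by (intro exI[of _ "M 0 0"] exI[of _ d]) simp
next
  case (Suc n)
  define M' where "M' i j = (\<lambda>q. M 0 0 q * M (Suc i) (Suc j) q - M (Suc i) 0 q * M 0 (Suc j) q)" for i j
  have "\<exists>P d'. coeffs_in s V P \<and> (\<forall>q. monic_upto d' 1 (P q)) \<and>
    (\<forall>q z \<nu>. (\<forall>i\<le>n. (\<Sum>j\<le>n. poly (M' i j q) z * \<nu> j) = 0) \<longrightarrow> poly (P q) z * \<nu> n = 0)"
  proof (rule Suc.IH)
    show "coeffs_in s V (M' i j)" if "i \<le> n" "j \<le> n" for i j
      unfolding M'_def using that by (intro coeffs_in_diff coeffs_in_mult Suc.prems) auto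
    show "monic_upto (d + d) (if i = j then 1 else 0) (M' i j q)" if "i \<le> n" "j \<le> n" for i j q
    proof -
      \<comment> \<open>Both factors of the subtracted product lie off the diagonal, so they have no
        term of degree \<open>d\<close> and the product has none of degree
        \<open>d + d\<close>.\<close>
      have "monic_upto (d + d) (1 * (if i = j then 1 else 0) - 0 * 0) (M' i j q)"
        unfolding M'_def using that Suc.prems(2)[of 0 0] Suc.prems(2)[of "Suc i" "Suc j"]
          Suc.prems(2)[of "Suc i" 0] Suc.prems(2)[of 0 "Suc j"]
        by (intro monic_upto_diff monic_upto_mult) auto
      then show ?thesis by simp
    qed
  qed
  then obtain P d' where P: "coeffs_in s V P" "\<forall>q. monic_upto d' 1 (P q)"
    "\<And>q z \<nu>. (\<forall>i\<le>n. (\<Sum>j\<le>n. poly (M' i j q) z * \<nu> j) = 0) \<Longrightarrow> poly (P q) z * \<nu> n = 0"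
    by blast
  have key: "poly (P q) z * \<nu> (Suc n) = 0"
    if h: "\<forall>i\<le>Suc n. (\<Sum>j\<le>Suc n. poly (M i j q) z * \<nu> j) = 0" for q z \<nu>
  proof (rule P(3)[of q z "\<lambda>j. \<nu> (Suc j)"], intro allI impI)
    fix i assume i: "i \<le> n"
    have split: "(\<Sum>j\<le>Suc n. poly (M i j q) z * \<nu> j)
        = poly (M i 0 q) z * \<nu> 0 + (\<Sum>j\<le>n. poly (M i (Suc j) q) z * \<nu> (Suc j))" for i
      by (rule sum.atMost_Suc_shift)
    have e: "(\<Sum>j\<le>n. poly (M i (Suc j) q) z * \<nu> (Suc j)) = - poly (M i 0 q) z * \<nu> 0"
      if "i \<le> Suc n" for i
      using h that unfolding split add_eq_0_iff mult_minus_left by blast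
    have "(\<Sum>j\<le>n. poly (M' i j q) z * \<nu> (Suc j)) =
        poly (M 0 0 q) z * (\<Sum>j\<le>n. poly (M (Suc i) (Suc j) q) z * \<nu> (Suc j))
        - poly (M (Suc i) 0 q) z * (\<Sum>j\<le>n. poly (M 0 (Suc j) q) z * \<nu> (Suc j))"
      unfolding M'_def sum_distrib_left sum_subtractf[symmetric]
      by (intro sum.cong refl) (simp add: algebra_simps)
    also have "\<dots> = 0"
      unfolding e[OF le0] e[OF Suc_le_mono[THEN iffD2, OF i]] by simp
    finally show "(\<Sum>j\<le>n. poly (M' i j q) z * \<nu> (Suc j)) = 0" .
  qed
  show ?case
    by (rule exI[of _ P], rule exI[of _ d'], intro conjI P(1-2) allI impI, rule key, assumption)
qed

subsection \<open>Integral elements of the fraction field\<close>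

text \<open>The numerator of the polynomial \<open>cs\<close> at a/b over the denominator b^(length
  cs). This exponent exceeds the degree by one, which lets the empty list fit the recursion.\<close>

primrec (in ring) homog_eval :: "'a list \<Rightarrow> 'a \<Rightarrow> 'a \<Rightarrow> 'a" where
  "homog_eval [] a b = \<zero>"
| "homog_eval (c # cs) a b = b \<otimes> (c \<otimes> a [^] length cs \<oplus> homog_eval cs a b)"

context domain
begin

lemma homog_eval_closed:
  "set cs \<subseteq> carrier R \<Longrightarrow> a \<in> carrier R \<Longrightarrow> b \<in> carrier R \<Longrightarrow> homog_eval cs a b \<in> carrier R"
  by (induction cs) auto

lemma nonzero_pow: "b \<in> carrier R - {\<zero>} \<Longrightarrow> b [^] (k::nat) \<in> carrier R - {\<zero>}"
  by (induction k) (auto simp: integral_iff)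

lemma Frac_pow:
  assumes "a \<in> carrier R" "b \<in> carrier R - {\<zero>}"
  shows "fraction R a b [^]\<^bsub>Frac R\<^esub> (k::nat) = fraction R (a [^] k) (b [^] k)"
proof (induction k)
  case (Suc k)
  have "fraction R a b [^]\<^bsub>Frac R\<^esub> Suc k
      = fraction R a b [^]\<^bsub>Frac R\<^esub> k \<otimes>\<^bsub>Frac R\<^esub> fraction R a b"
    by (simp add: nat_pow_def)
  then show ?case using assms nonzero_pow[of b k] by (simp add: Suc Frac_mult)
qed (simp add: nat_pow_def Frac_one)

lemma eval_fraction:
  assumes "set cs \<subseteq> carrier R" "a \<in> carrier R" "b \<in> carrier R - {\<zero>}"
  shows "ring.eval (Frac R) (map (\<lambda>c. fraction R c \<one>) cs) (fraction R a b)
    = fraction R (homog_eval cs a b) (b [^] length cs)"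
  using assms(1)
proof (induction cs)
  interpret F: field "Frac R" by (rule field_Frac)
  case Nil
  then show ?case by (simp add: Frac_zero)
next
  interpret F: field "Frac R" by (rule field_Frac)
  case (Cons c cs)
  let ?l = "length cs"
  have c: "c \<in> carrier R" "set cs \<subseteq> carrier R" using Cons.prems by auto
  have h: "homog_eval cs a b \<in> carrier R" using c assms by (intro homog_eval_closed) auto
  have bl: "b [^] ?l \<in> carrier R - {\<zero>}" by (rule nonzero_pow[OF assms(3)])
  have b: "b \<in> carrier R" "a [^] ?l \<in> carrier R" using assms by auto
  have one: "\<one> \<in> carrier R - {\<zero>}" by simp
  have "ring.eval (Frac R) (map (\<lambda>c. fraction R c \<one>) (c # cs)) (fraction R a b)
    = fraction R c \<one> \<otimes>\<^bsub>Frac R\<^esub> fraction R (a [^] ?l) (b [^] ?l)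
      \<oplus>\<^bsub>Frac R\<^esub> fraction R (homog_eval cs a b) (b [^] ?l)"
    using Cons.IH[OF c(2)] by (simp add: Frac_pow[OF assms(2,3)])
  also have "\<dots> = fraction R (c \<otimes> a [^] ?l) (b [^] ?l)
      \<oplus>\<^bsub>Frac R\<^esub> fraction R (homog_eval cs a b) (b [^] ?l)"
    using c b bl by (simp add: Frac_mult[OF c(1) one b(2) bl])
  also have "\<dots> = fraction R (c \<otimes> a [^] ?l \<otimes> b [^] ?l \<oplus> homog_eval cs a b \<otimes> b [^] ?l)
      (b [^] ?l \<otimes> b [^] ?l)"
    using c b bl h by (intro Frac_add) auto
  also have "\<dots> = fraction R (homog_eval (c # cs) a b) (b [^] length (c # cs))"
    using c b bl h assms by (subst fraction_eq_iff) (auto simp: integral_iff l_distr r_distr m_ac)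
  finally show ?case .
qed

text \<open>The last hypothesis is a monic equation for a/b with denominators cleared, so
  integrality can be verified inside \<open>R\<close> without computing in the fraction
  field.\<close>

lemma integrally_closed_divides:
  assumes "integrally_closed_domain R" "a \<in> carrier R" "b \<in> carrier R - {\<zero>}"
    "set cs \<subseteq> carrier R" "homog_eval (\<one> # cs) a b = \<zero>"
  shows "\<exists>c\<in>carrier R. a = c \<otimes> b"
proof -
  interpret F: field "Frac R" by (rule field_Frac)
  let ?i = "\<lambda>c. fraction R c \<one>"
  let ?p = "map ?i (\<one> # cs)"
  have one: "\<one> \<in> carrier R - {\<zero>}" by simp
  have "polynomial\<^bsub>Frac R\<^esub> (?i ` carrier R) ?p"
    using assms(4) F.one_not_zero by (auto simp: polynomial_def Frac_one)
  moreover have "ring.eval (Frac R) ?p (fraction R a b) = \<zero>\<^bsub>Frac R\<^esub>"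
    using assms nonzero_pow[OF assms(3), of "length (\<one> # cs)"]
    by (subst eval_fraction) (auto simp: Frac_zero fraction_eq_iff simp del: homog_eval.simps)
  ultimately have "integral_over (Frac R) (?i ` carrier R) (fraction R a b)"
    unfolding integral_over_def by (intro exI[of _ ?p]) (simp add: Frac_one)
  then obtain c where "c \<in> carrier R" "fraction R a b = fraction R c \<one>"
    using assms(1) fraction_in_Frac[OF assms(2,3)] unfolding integrally_closed_domain_def by blast
  then show ?thesis using assms(2,3) one by (auto simp: fraction_eq_iff)
qed

end

section \<open>Integrality over the coordinate ring of a closure\<close>

lemma coordinate_ring_pow:
  assumes "z \<in> Z"
  shows "(f [^]\<^bsub>coordinate_ring s V Z\<^esub> (k::nat)) z = f z ^ k"
  using assms by (induction k) (auto simp: nat_pow_def coordinate_ring_def)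

text \<open>The relation \<open>b z * w = a z\<close> takes the place of w = a/b and also covers
  points with \<open>b z = 0\<close>. The list is reversed because the leading coefficient comes
  first.\<close>

lemma homog_eval_coordinate_ring:
  assumes "z \<in> Z" "b z * w = a z" "\<And>i. i < d \<Longrightarrow> c i z = coeff p i"
  shows "ring.homog_eval (coordinate_ring s V Z) (map c (rev [0..<d])) a b z
    = b z ^ d * (\<Sum>i<d. coeff p i * w ^ i)"
proof -
  interpret R: cring "coordinate_ring s V Z" by (rule coordinate_ring_cring)
  let ?R = "coordinate_ring s V Z"
  have ops: "(f \<otimes>\<^bsub>?R\<^esub> g) z = f z * g z" "(f \<oplus>\<^bsub>?R\<^esub> g) z = f z + g z" "\<zero>\<^bsub>?R\<^esub> z = 0"
    for f g using assms(1) by (simp_all add: coordinate_ring_def)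
  show ?thesis
    using assms(3)
  proof (induction d)
    case (Suc d)
    then have "R.homog_eval (map c (rev [0..<d])) a b z = b z ^ d * (\<Sum>i<d. coeff p i * w ^ i)"
      "c d z = coeff p d"
      by simp_all
    then show ?case
      by (simp add: ops coordinate_ring_pow[OF assms(1)] assms(2)[symmetric] algebra_simps
        power_mult_distrib)
  qed (simp add: ops)
qed

text \<open>Integrality of \<open>a / b\<close> only has to be checked on \<open>S\<close>, where \<open>b\<close> may vanish.\<close>

lemma integrally_closed_coordinate_ring_divides:
  assumes icd: "integrally_closed_domain (coordinate_ring s V (zariski_closure s V S))"
    and S: "S \<subseteq> V"
    and a: "a \<in> poly_funs s V" and b: "b \<in> poly_funs s V" and y: "y \<in> S" "b y \<noteq> 0"
    and p: "\<And>i. (\<lambda>x. coeff (p x) i) \<in> poly_funs s V"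
      "\<And>x. coeff (p x) d = 1" "\<And>x i. i > d \<Longrightarrow> coeff (p x) i = 0"
    and w: "\<And>x. x \<in> S \<Longrightarrow> \<exists>w. b x * w = a x \<and> (b x \<noteq> 0 \<longrightarrow> poly (p x) w = 0)"
  shows "\<exists>c\<in>poly_funs s V. \<forall>x\<in>S. a x = c x * b x"
proof -
  define Z where "Z = zariski_closure s V S"
  define R where "R = coordinate_ring s V Z"
  interpret R: domain R using icd by (simp add: integrally_closed_domain_def R_def Z_def)
  have Z: "Z = {x \<in> V. \<forall>f\<in>poly_funs s V. (\<forall>y\<in>S. f y = 0) \<longrightarrow> f x = 0}"
    unfolding Z_def by (rule zariski_closure_eq[OF S])
  have SZ: "S \<subseteq> Z" using S by (auto simp: Z)
  have car: "restrict f Z \<in> carrier R" if "f \<in> poly_funs s V" for f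
    using that by (simp add: R_def coordinate_ring_def)
  \<comment> \<open>Polynomial functions vanishing on \<open>S\<close> vanish on its closure; hence
    identities in the coordinate ring may be tested on \<open>S\<close> alone.\<close>
  have zero: "f = \<zero>\<^bsub>R\<^esub>" if f: "f \<in> carrier R" "\<And>x. x \<in> S \<Longrightarrow> f x = 0" for f
  proof -
    obtain g where g: "g \<in> poly_funs s V" "f = restrict g Z"
      using f(1) by (auto simp: R_def coordinate_ring_def)
    have "g x = 0" if "x \<in> S" for x using f(2)[OF that] SZ that g(2) by auto
    then have "g x = 0" if "x \<in> Z" for x using that g(1) by (auto simp: Z)
    then show ?thesis by (auto simp: g(2) R_def coordinate_ring_def)
  qed
  let ?c = "\<lambda>i. restrict (\<lambda>x. coeff (p x) i) Z"
  let ?cs = "map ?c (rev [0..<d])"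
  have cs: "set ?cs \<subseteq> carrier R" using car p(1) by auto
  have one: "\<one>\<^bsub>R\<^esub> = ?c d" using p(2) by (simp add: R_def coordinate_ring_def)
  have "restrict b Z \<noteq> \<zero>\<^bsub>R\<^esub>"
  proof
    assume "restrict b Z = \<zero>\<^bsub>R\<^esub>"
    then have "restrict b Z y = 0" using y SZ by (auto simp: R_def coordinate_ring_def)
    then show False using y SZ by auto
  qed
  then have bZ: "restrict b Z \<in> carrier R - {\<zero>\<^bsub>R\<^esub>}" using car[OF b] by simp
  have "R.homog_eval (\<one>\<^bsub>R\<^esub> # ?cs) (restrict a Z) (restrict b Z) = \<zero>\<^bsub>R\<^esub>"
  proof (rule zero)
    show "R.homog_eval (\<one>\<^bsub>R\<^esub> # ?cs) (restrict a Z) (restrict b Z) \<in> carrier R"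
      using cs bZ car[OF a] by (intro R.homog_eval_closed) auto
  next
    fix x assume x: "x \<in> S"
    then have xZ: "x \<in> Z" using SZ by auto
    obtain v where v: "b x * v = a x" "b x \<noteq> 0 \<Longrightarrow> poly (p x) v = 0" using w[OF x] by blast
    have deg: "Polynomial.degree (p x) \<le> d" using p(3) by (intro degree_le) auto
    have list: "\<one>\<^bsub>R\<^esub> # ?cs = map ?c (rev [0..<Suc d])" using one by simp
    have "R.homog_eval (\<one>\<^bsub>R\<^esub> # ?cs) (restrict a Z) (restrict b Z) x
      = restrict b Z x ^ Suc d * (\<Sum>i<Suc d. coeff (p x) i * v ^ i)"
      unfolding list unfolding R_def using xZ v(1)
      by (intro homog_eval_coordinate_ring) auto
    also have "(\<Sum>i<Suc d. coeff (p x) i * v ^ i) = poly (p x) v"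
      unfolding poly_altdef using deg
      by (intro sum.mono_neutral_right) (auto simp: coeff_eq_0)
    \<comment> \<open>Where \<open>b\<close> vanishes its positive power makes the product zero;
      elsewhere \<open>v\<close> is a root.\<close>
    also have "restrict b Z x ^ Suc d * poly (p x) v = 0"
      using v(2) xZ by (cases "b x = 0") auto
    finally show "R.homog_eval (\<one>\<^bsub>R\<^esub> # ?cs) (restrict a Z) (restrict b Z) x = 0" .
  qed
  then obtain c where c: "c \<in> carrier R" "restrict a Z = c \<otimes>\<^bsub>R\<^esub> restrict b Z"
    using R.integrally_closed_divides[OF _ car[OF a] bZ cs] icd by (auto simp: R_def Z_def)
  obtain g where g: "g \<in> poly_funs s V" "c = restrict g Z"
    using c(1) by (auto simp: R_def coordinate_ring_def)
  have "a x = g x * b x" if "x \<in> S" for x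
    using fun_cong[OF c(2), of x] that SZ by (auto simp: g(2) R_def coordinate_ring_def)
  then show ?thesis using g(1) by blast
qed

subsection \<open>Coefficients of a product with a power of a linear form\<close>

text \<open>On the line w + theta v a point l^k h becomes (b + a theta)^k H with a = l(v), b = l(w).
  The coefficients of this product are linear in q, those of H are not. Membership says that an
  expression in a, b, H is a combination of monomials of degree \<open>d\<close> in a, b with
  coefficients linear in q.\<close>

inductive_set coeff_span :: "nat \<Rightarrow> nat \<Rightarrow> nat \<Rightarrow> (complex \<Rightarrow> complex \<Rightarrow> complex poly \<Rightarrow> complex) set"
  for k N d where
    base: "g \<le> d \<Longrightarrow> j \<le> N \<Longrightarrow>
      (\<lambda>a b H. coeff ([:b, a:] ^ k * H) j * (a ^ g * b ^ (d - g))) \<in> coeff_span k N d"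
  | zero: "(\<lambda>a b H. 0) \<in> coeff_span k N d"
  | add: "f \<in> coeff_span k N d \<Longrightarrow> f' \<in> coeff_span k N d \<Longrightarrow>
      (\<lambda>a b H. f a b H + f' a b H) \<in> coeff_span k N d"
  | scale: "f \<in> coeff_span k N d \<Longrightarrow> (\<lambda>a b H. c * f a b H) \<in> coeff_span k N d"

lemma coeff_span_sum:
  assumes "\<And>i. i \<in> I \<Longrightarrow> f i \<in> coeff_span k N d"
  shows "(\<lambda>a b H. \<Sum>i\<in>I. f i a b H) \<in> coeff_span k N d"
  using assms
proof (induction I rule: infinite_finite_induct)
  case (insert i I)
  then have "(\<lambda>a b H. f i a b H + (\<Sum>i\<in>I. f i a b H)) \<in> coeff_span k N d"
    by (intro coeff_span.add insert.IH) auto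
  then show ?case using insert.hyps by simp
qed (simp_all add: coeff_span.zero)

lemma coeff_span_mult:
  assumes "f \<in> coeff_span k N d"
  shows "(\<lambda>a b H. a ^ i * b ^ l * f a b H) \<in> coeff_span k N (d + i + l)"
  using assms
proof induction
  case (base g j)
  have eq: "(\<lambda>a b H. a ^ i * b ^ l * (coeff ([:b, a:] ^ k * H) j * (a ^ g * b ^ (d - g))))
    = (\<lambda>a b H. coeff ([:b, a:] ^ k * H) j * (a ^ (g + i) * b ^ (d + i + l - (g + i))))"
  proof -
    have "d + i + l - (g + i) = l + (d - g)" using base by simp
    then show ?thesis by (simp add: power_add mult_ac)
  qed
  show ?case unfolding eq using base by (intro coeff_span.base) auto
next
  case (add f f')
  then show ?case by (simp only: distrib_left coeff_span.add)
next
  case (scale f c)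
  then show ?case using coeff_span.scale[OF scale.IH, of c] by (simp add: mult_ac)
qed (simp add: coeff_span.zero)

text \<open>The scalars \<open>\<kappa>\<close> do not depend on a, b, H, so they define one matrix
  that serves all points q.\<close>

lemma coeff_span_expand:
  assumes "f \<in> coeff_span k N d"
  shows "\<exists>\<kappa>. \<forall>a b H. f a b H =
    (\<Sum>g\<le>d. (\<Sum>j\<le>N. \<kappa> g j * coeff ([:b, a:] ^ k * H) j) * (a ^ g * b ^ (d - g)))"
  using assms
proof induction
  case (base g j)
  have "(\<Sum>j'\<le>N. (if g' = g \<and> j' = j then 1 else 0) * coeff P j')
      = (if g' = g then coeff P j else 0)" for g' and P :: "complex poly"
    using base(2) by (cases "g' = g") (simp_all add: if_distrib[of "\<lambda>x. x * _"] sum.delta cong: if_cong)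
  then have "(\<Sum>g'\<le>d. (\<Sum>j'\<le>N. (if g' = g \<and> j' = j then 1 else 0) * coeff P j') * Y g')
      = coeff P j * Y g" for P :: "complex poly" and Y
    using base(1) by (simp add: if_distrib[of "\<lambda>x. x * _"] sum.delta cong: if_cong)
  then show ?case by (intro exI[of _ "\<lambda>g' j'. if g' = g \<and> j' = j then 1 else 0"]) simp
next
  case zero
  then show ?case by (intro exI[of _ "\<lambda>_ _. 0"]) simp
next
  case (add f f')
  then obtain \<kappa> \<kappa>' where
    "\<And>a b H. f a b H =
      (\<Sum>g\<le>d. (\<Sum>j\<le>N. \<kappa> g j * coeff ([:b, a:] ^ k * H) j) * (a ^ g * b ^ (d - g)))"
    "\<And>a b H. f' a b H =
      (\<Sum>g\<le>d. (\<Sum>j\<le>N. \<kappa>' g j * coeff ([:b, a:] ^ k * H) j) * (a ^ g * b ^ (d - g)))"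
    by blast
  then show ?case
    by (intro exI[of _ "\<lambda>g j. \<kappa> g j + \<kappa>' g j"]) (simp add: distrib_right sum.distrib)
next
  case (scale f c)
  then obtain \<kappa> where
    "\<And>a b H. f a b H =
      (\<Sum>g\<le>d. (\<Sum>j\<le>N. \<kappa> g j * coeff ([:b, a:] ^ k * H) j) * (a ^ g * b ^ (d - g)))"
    by blast
  then show ?case
    by (intro exI[of _ "\<lambda>g j. c * \<kappa> g j"])
       (simp add: sum_distrib_left sum_distrib_right mult_ac)
qed

text \<open>The convolution formula for the coefficient \<open>j\<close> of the product contains b^k
  times the coefficient \<open>j\<close> of \<open>H\<close> and otherwise only earlier
  coefficients. Solving it recursively costs a factor b^k at each stage, whence the exponent
  \<open>k * Suc j\<close>; \<open>j \<le> k\<close> keeps the exponents k - (j - i)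
  meaningful.\<close>

lemma low_coeff_in_coeff_span:
  assumes "j \<le> k" "j \<le> N"
  shows "(\<lambda>a b H. b ^ (k * Suc j) * coeff H j) \<in> coeff_span k N (k * j)"
  using assms
proof (induction j rule: less_induct)
  case (less j)
  let ?c = "\<lambda>i. of_nat (k choose (j - i)) :: complex"
  have expand: "coeff ([:b, a:] ^ k * H) j
      = b ^ k * coeff H j + (\<Sum>i<j. ?c i * a ^ (j - i) * b ^ (k - (j - i)) * coeff H i)"
    for a b :: complex and H
  proof -
    have "coeff ([:b, a:] ^ k * H) j = (\<Sum>i\<le>j. coeff H i * coeff ([:b, a:] ^ k) (j - i))"
      by (subst mult.commute) (rule coeff_mult)
    also have "\<dots> = (\<Sum>i\<le>j. ?c i * a ^ (j - i) * b ^ (k - (j - i)) * coeff H i)"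
      using less.prems by (intro sum.cong refl) (subst coeff_linear_poly_power, auto)
    also have "{..j} = insert j {..<j}" by auto
    finally show ?thesis by simp
  qed
  have "(\<lambda>a b H. b ^ (k * Suc j) * coeff H j) = (\<lambda>a b H.
      coeff ([:b, a:] ^ k * H) j * (a ^ 0 * b ^ (k * j - 0)) +
      (\<Sum>i<j. (- ?c i) * (a ^ (j - i) * b ^ ((k - 1) * (j - i)) * (b ^ (k * Suc i) * coeff H i))))"
  proof (intro ext)
    fix a b :: complex and H :: "complex poly"
    have "(k - 1) * (j - i) + k * Suc i = k * j + (k - (j - i))" if ij: "i < j" for i
    proof -
      obtain d where d: "j = i + d" using le_Suc_ex[OF less_imp_le[OF ij]] by blast
      have "d \<le> k" using d less.prems by simp
      then obtain r where r: "k = d + r" using le_Suc_ex by blast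
      have "d > 0" using ij d by simp
      then obtain d' where d': "d = Suc d'" by (cases d) auto
      show ?thesis unfolding d r d' by (simp add: algebra_simps)
    qed
    then have "b ^ ((k - 1) * (j - i)) * b ^ (k * Suc i) = b ^ (k * j) * b ^ (k - (j - i))"
      if "i < j" for i using that by (simp only: power_add[symmetric])
    then have "(\<Sum>i<j. (- ?c i) * (a ^ (j - i) * b ^ ((k - 1) * (j - i)) * (b ^ (k * Suc i) * coeff H i)))
      = - (b ^ (k * j)) * (\<Sum>i<j. ?c i * a ^ (j - i) * b ^ (k - (j - i)) * coeff H i)"
      unfolding sum_distrib_left by (intro sum.cong refl) (simp add: mult_ac del: mult_Suc_right)
    then show "b ^ (k * Suc j) * coeff H j = coeff ([:b, a:] ^ k * H) j * (a ^ 0 * b ^ (k * j - 0)) +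
      (\<Sum>i<j. (- ?c i) * (a ^ (j - i) * b ^ ((k - 1) * (j - i)) * (b ^ (k * Suc i) * coeff H i)))"
      unfolding expand by (simp add: power_add algebra_simps)
  qed
  moreover have "(\<lambda>a b H. a ^ (j - i) * b ^ ((k - 1) * (j - i)) * (b ^ (k * Suc i) * coeff H i))
      \<in> coeff_span k N (k * j)" if ij: "i < j" for i
  proof -
    have "k * i + (j - i) + (k - 1) * (j - i) = k * j"
    proof -
      obtain d where d: "j = i + d" using le_Suc_ex[OF less_imp_le[OF ij]] by blast
      obtain k' where "k = Suc k'" using ij less.prems by (cases k) auto
      then show ?thesis using d by (simp add: algebra_simps)
    qed
    then show ?thesis
      using coeff_span_mult[OF less.IH[of i], of "j - i" "(k - 1) * (j - i)"] that less.prems by simp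
  qed
  ultimately show ?case
    using less.prems
    by (simp only:) (intro coeff_span.add coeff_span.base coeff_span_sum coeff_span.scale; simp)
qed

text \<open>If f >= k, a factor a^k of the monomial is traded for the factor b^k of F, because a^k
  times the coefficient n of \<open>H\<close> is the top coefficient of the product. If f < k, the
  power of b is at least k (n + 1) and the coefficient n of \<open>H\<close> can be recovered from
  below. The value of \<open>D\<close> is chosen so that these two cases cover all f.\<close>

lemma leading_coeff_relation:
  assumes "n \<le> k" and D: "D = k * Suc n"
  shows "\<exists>\<kappa> :: nat \<Rightarrow> nat \<Rightarrow> nat \<Rightarrow> complex. \<forall>f\<le>D. \<forall>a b H. Polynomial.degree H \<le> n \<longrightarrow>
    b ^ k * coeff H n * (a ^ f * b ^ (D - f)) =
    (\<Sum>g\<le>D. (\<Sum>j\<le>k + n. \<kappa> f g j * coeff ([:b, a:] ^ k * H) j) * (a ^ g * b ^ (D - g)))"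
proof -
  have "\<exists>\<kappa> :: nat \<Rightarrow> nat \<Rightarrow> complex. \<forall>a b H. Polynomial.degree H \<le> n \<longrightarrow> b ^ k * coeff H n * (a ^ f * b ^ (D - f)) =
    (\<Sum>g\<le>D. (\<Sum>j\<le>k + n. \<kappa> g j * coeff ([:b, a:] ^ k * H) j) * (a ^ g * b ^ (D - g)))"
    if f: "f \<le> D" for f
  proof (cases "f < k")
    case True
    have mem: "(\<lambda>a b H. a ^ f * b ^ (k - f) * (b ^ (k * Suc n) * coeff H n))
        \<in> coeff_span k (k + n) (k * n + f + (k - f))"
      using assms by (intro coeff_span_mult low_coeff_in_coeff_span) auto
    have dim: "k * n + f + (k - f) = D" using True D by simp
    have eq: "a ^ f * b ^ (k - f) * (b ^ (k * Suc n) * coeff H n)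
      = b ^ k * coeff H n * (a ^ f * b ^ (D - f))" for a b :: complex and H
    proof -
      have "k - f + k * Suc n = k + (D - f)" using True D by simp
      then have "b ^ (k - f) * b ^ (k * Suc n) = b ^ k * b ^ (D - f)"
        by (simp only: power_add[symmetric])
      then show ?thesis by (simp add: mult_ac del: mult_Suc_right)
    qed
    show ?thesis using coeff_span_expand[OF mem] unfolding dim eq by (elim ex_forward) blast
  next
    case False
    have mem: "(\<lambda>a b H. coeff ([:b, a:] ^ k * H) (k + n) * (a ^ (f - k) * b ^ (D - (f - k))))
        \<in> coeff_span k (k + n) D"
      using f by (intro coeff_span.base) auto
    have eq: "coeff ([:b, a:] ^ k * H) (k + n) * (a ^ (f - k) * b ^ (D - (f - k)))
      = b ^ k * coeff H n * (a ^ f * b ^ (D - f))" if "Polynomial.degree H \<le> n"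
      for a b :: complex and H
    proof -
      have "coeff ([:b, a:] ^ k * H) (k + n) = a ^ k * coeff H n"
      proof -
        have deg: "Polynomial.degree ([:b, a:] ^ k) \<le> k"
          using degree_power_le[of "[:b, a:]" k] by (simp split: if_splits)
        have "coeff ([:b, a:] ^ k * H) (k + n)
            = (\<Sum>i\<le>k + n. if i = k then coeff ([:b, a:] ^ k) k * coeff H n else 0)"
          unfolding coeff_mult
        proof (intro sum.cong refl)
          fix i
          have "coeff ([:b, a:] ^ k) i = 0" if "i > k" using that deg by (intro coeff_eq_0) simp
          moreover have "coeff H (k + n - i) = 0" if "i < k"
            using that \<open>Polynomial.degree H \<le> n\<close> by (intro coeff_eq_0) simp
          ultimately show "coeff ([:b, a:] ^ k) i * coeff H (k + n - i)
              = (if i = k then coeff ([:b, a:] ^ k) k * coeff H n else 0)"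
            by (cases i k rule: linorder_cases) auto
        qed
        then show ?thesis by (simp add: sum.delta coeff_linear_poly_power)
      qed
      moreover have "k + (D - f) = D - (f - k)" "f = k + (f - k)" using False f by auto
      then have "b ^ k * b ^ (D - f) = b ^ (D - (f - k))" "a ^ f = a ^ k * a ^ (f - k)"
        by (simp_all only: power_add[symmetric])
      ultimately show ?thesis by (simp add: mult_ac)
    qed
    obtain \<kappa> :: "nat \<Rightarrow> nat \<Rightarrow> complex" where "\<And>a b H. coeff ([:b, a:] ^ k * H) (k + n) * (a ^ (f - k) * b ^ (D - (f - k))) =
        (\<Sum>g\<le>D. (\<Sum>j\<le>k + n. \<kappa> g j * coeff ([:b, a:] ^ k * H) j) * (a ^ g * b ^ (D - g)))"
      using coeff_span_expand[OF mem] by blast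
    then show ?thesis by (intro exI[of _ \<kappa>]) (metis eq)
  qed
  then have "\<forall>f. \<exists>\<kappa> :: nat \<Rightarrow> nat \<Rightarrow> complex. f \<le> D \<longrightarrow> (\<forall>a b H. Polynomial.degree H \<le> n \<longrightarrow>
    b ^ k * coeff H n * (a ^ f * b ^ (D - f)) =
    (\<Sum>g\<le>D. (\<Sum>j\<le>k + n. \<kappa> g j * coeff ([:b, a:] ^ k * H) j) * (a ^ g * b ^ (D - g))))"
    by simp
  from choice[OF this] show ?thesis by simp
qed

subsection \<open>Coefficients along planes\<close>

lemma mscale_nth [simp]: "mscale c A $ i $ j = c * A $ i $ j"
  by (simp add: mscale_def)

definition poly2 :: "complex poly poly \<Rightarrow> complex \<Rightarrow> complex \<Rightarrow> complex" where
  "poly2 r \<sigma> \<tau> = poly (poly r [:\<sigma>:]) \<tau>"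

lemma poly2_unique:
  assumes "\<And>\<sigma> \<tau>. poly2 r \<sigma> \<tau> = poly2 r' \<sigma> \<tau>"
  shows "r = r'"
proof -
  have "poly r [:\<sigma>:] = poly r' [:\<sigma>:]" for \<sigma>
    using assms unfolding poly2_def by (simp add: poly_eq_poly_eq_iff[symmetric] fun_eq_iff)
  then have "range (\<lambda>\<sigma>. [:\<sigma>:]) \<subseteq> {p. poly (r - r') p = 0}" by auto
  moreover have "infinite (range (\<lambda>\<sigma> :: complex. [:\<sigma>:]))"
    by (auto dest!: finite_imageD simp: inj_on_def infinite_UNIV_char_0)
  ultimately have "infinite {p. poly (r - r') p = 0}" using finite_subset by blast
  then have "r - r' = 0" using poly_roots_finite by blast
  then show ?thesis by simp
qed

lemma homog_polys_on_plane:
  assumes "q \<in> homog_polys d"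
  shows "\<exists>r. \<forall>\<sigma> \<tau>. q (x + mscale \<sigma> y + mscale \<tau> z) = poly2 r \<sigma> \<tau>"
proof -
  obtain c where c: "\<And>A. q A = (\<Sum>\<alpha>\<in>exps d. c \<alpha> * mon \<alpha> A)" using homog_polysD[OF assms] by blast
  let ?e = "\<lambda>i j. [:[:x $ i $ j, z $ i $ j:], [:y $ i $ j:]:]"
  have "q (x + mscale \<sigma> y + mscale \<tau> z)
    = poly2 (\<Sum>\<alpha>\<in>exps d. [:[:c \<alpha>:]:] * (\<Prod>i\<in>UNIV. \<Prod>j\<in>UNIV. ?e i j ^ \<alpha> i j)) \<sigma> \<tau>" for \<sigma> \<tau>
    unfolding c poly2_def by (simp add: poly_sum poly_prod algebra_simps)
  then show ?thesis by blast
qed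

text \<open>For forms \<open>q\<close> the polynomial under \<open>THE\<close> exists and is
  determined by its values. These coefficients, with \<open>z = 0\<close> for lines, are linear in
  \<open>q\<close>; together with evaluation at one point they supply all linear forms from which
  numerator, denominator and integral equation are built.\<close>

definition plane_coeff ::
  "complex^'m^'m \<Rightarrow> complex^'m^'m \<Rightarrow> complex^'m^'m \<Rightarrow> nat \<Rightarrow> nat \<Rightarrow>
    (complex^'m^'m::finite \<Rightarrow> complex) \<Rightarrow> complex" where
  "plane_coeff x y z i j q =
     coeff (coeff (THE r. \<forall>\<sigma> \<tau>. q (x + mscale \<sigma> y + mscale \<tau> z) = poly2 r \<sigma> \<tau>) i) j"

lemma plane_coeff_eq:
  assumes "\<And>\<sigma> \<tau>. q (x + mscale \<sigma> y + mscale \<tau> z) = poly2 r \<sigma> \<tau>"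
  shows "plane_coeff x y z i j q = coeff (coeff r i) j"
proof -
  have "(THE r. \<forall>\<sigma> \<tau>. q (x + mscale \<sigma> y + mscale \<tau> z) = poly2 r \<sigma> \<tau>) = r"
    using assms by (intro the_equality) (auto intro: poly2_unique)
  then show ?thesis by (simp add: plane_coeff_def)
qed

lemma linear_form_plane_coeff: "linear_form_on fscale (homog_polys d) (plane_coeff x y z i j)"
  unfolding linear_form_on_def
proof (intro conjI ballI allI)
  fix q q' :: "complex^'a^'a \<Rightarrow> complex" and c
  assume "q \<in> homog_polys d" "q' \<in> homog_polys d"
  then obtain r r' where r: "\<And>\<sigma> \<tau>. q (x + mscale \<sigma> y + mscale \<tau> z) = poly2 r \<sigma> \<tau>"
    "\<And>\<sigma> \<tau>. q' (x + mscale \<sigma> y + mscale \<tau> z) = poly2 r' \<sigma> \<tau>"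
    using homog_polys_on_plane by metis
  have "plane_coeff x y z i j (q + q') = coeff (coeff (r + r') i) j"
    by (rule plane_coeff_eq) (simp add: r poly2_def)
  then show "plane_coeff x y z i j (q + q') = plane_coeff x y z i j q + plane_coeff x y z i j q'"
    by (simp add: plane_coeff_eq[OF r(1)] plane_coeff_eq[OF r(2)])
next
  fix q :: "complex^'a^'a \<Rightarrow> complex" and c
  assume "q \<in> homog_polys d"
  then obtain r where r: "\<And>\<sigma> \<tau>. q (x + mscale \<sigma> y + mscale \<tau> z) = poly2 r \<sigma> \<tau>"
    using homog_polys_on_plane by metis
  have "plane_coeff x y z i j (fscale c q) = coeff (coeff ([:[:c:]:] * r) i) j"
    by (rule plane_coeff_eq) (simp add: r poly2_def fscale_def)
  then show "plane_coeff x y z i j (fscale c q) = c * plane_coeff x y z i j q"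
    by (simp add: plane_coeff_eq[OF r])
qed

lemma plane_coeff_poly_funs: "plane_coeff x y z i j \<in> poly_funs fscale (homog_polys d)"
  by (rule poly_funs.linear) (rule linear_form_plane_coeff)

text \<open>Two summands are the shape that occurs later: a product of functions of single variables
  times a factor \<tau> + c + \<sigma> that mixes them.\<close>

lemma plane_coeff_products:
  assumes "\<And>\<sigma> \<tau>. q (x + mscale \<sigma> y + mscale \<tau> z) = poly P \<sigma> * poly G \<tau> + poly P' \<sigma> * poly G' \<tau>"
  shows "plane_coeff x y z i j q = coeff P i * coeff G j + coeff P' i * coeff G' j"
proof -
  have "poly2 (map_poly (\<lambda>c. Polynomial.smult c G) P) \<sigma> \<tau> = poly P \<sigma> * poly G \<tau>" for P G \<sigma> \<tau>
    unfolding poly2_def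
    by (induction P) (simp_all add: map_poly_pCons algebra_simps)
  then have "plane_coeff x y z i j q
      = coeff (coeff (map_poly (\<lambda>c. Polynomial.smult c G) P + map_poly (\<lambda>c. Polynomial.smult c G') P') i) j"
    by (intro plane_coeff_eq) (simp add: assms poly2_def)
  then show ?thesis by (simp add: coeff_map_poly)
qed

lemma plane_coeff_line:
  assumes "\<And>\<sigma>. q (x + mscale \<sigma> y) = poly P \<sigma>"
  shows "plane_coeff x y 0 i 0 q = coeff P i"
proof -
  have "mscale \<tau> (0 :: complex^'a^'a) = 0" for \<tau> by (simp add: vec_eq_iff)
  then show ?thesis using plane_coeff_products[of q x y 0 P 1 0 0 i 0] assms by simp
qed

text \<open>The sum is the coefficient of \<open>\<theta>\<close> to the power \<open>n + 1\<close> in \<open>q (x + \<theta> (b y - a z))\<close>.\<close>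

lemma plane_coeff_relation:
  assumes q: "q \<in> homog_polys d"
    and T: "Polynomial.degree T \<le> n"
      "\<And>\<theta>. q (x + mscale (b * \<theta>) y + mscale (- a * \<theta>) z) = poly T \<theta>"
  shows "(\<Sum>j\<le>Suc n. plane_coeff x y z (Suc n - j) j q * (b ^ (Suc n - j) * (- a) ^ j)) = 0"
proof -
  obtain r where r: "\<And>\<sigma> \<tau>. q (x + mscale \<sigma> y + mscale \<tau> z) = poly2 r \<sigma> \<tau>"
    using homog_polys_on_plane[OF q] by metis
  \<comment> \<open>Large enough to include every coefficient of \<open>r\<close> and the exponent
    \<open>Suc n\<close> that is read off.\<close>
  define N where "N = max (Suc n) (Polynomial.degree r)"
  define R where "R = (\<Sum>i\<le>N. monom (b ^ i) i * pcompose (coeff r i) [:0, - a:])"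
  have "poly R \<theta> = poly T \<theta>" for \<theta>
  proof -
    have "poly r p = (\<Sum>i\<le>N. coeff r i * p ^ i)" for p
      unfolding poly_altdef
      by (rule sum.mono_neutral_left) (auto simp: N_def coeff_eq_0)
    then have "poly2 r (b * \<theta>) (- a * \<theta>) = (\<Sum>i\<le>N. poly (coeff r i) (- a * \<theta>) * (b * \<theta>) ^ i)"
      by (simp add: poly2_def poly_sum)
    also have "\<dots> = poly R \<theta>"
      unfolding R_def poly_sum by (intro sum.cong refl) (simp add: poly_pcompose poly_monom power_mult_distrib mult_ac)
    finally show ?thesis using T(2)[of \<theta>] by (simp only: r)
  qed
  then have "R = T" by (simp add: poly_eq_poly_eq_iff[symmetric] fun_eq_iff)
  then have "coeff R (Suc n) = 0" using T(1) by (simp add: coeff_eq_0)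
  moreover have "coeff R (Suc n) = (\<Sum>i\<le>Suc n. b ^ i * ((- a) ^ (Suc n - i) * coeff (coeff r i) (Suc n - i)))"
  proof -
    have "coeff R (Suc n) = (\<Sum>i\<le>N. if Suc n < i then 0
        else b ^ i * ((- a) ^ (Suc n - i) * coeff (coeff r i) (Suc n - i)))"
      unfolding R_def coeff_sum coeff_monom_mult by (simp only: coeff_pcompose_linear)
    also have "\<dots> = (\<Sum>i\<le>Suc n. if Suc n < i then 0
        else b ^ i * ((- a) ^ (Suc n - i) * coeff (coeff r i) (Suc n - i)))"
      by (rule sum.mono_neutral_right) (auto simp: N_def)
    finally show ?thesis by simp
  qed
  moreover have "\<dots> = (\<Sum>j\<le>Suc n. b ^ (Suc n - j) * ((- a) ^ j * coeff (coeff r (Suc n - j)) j))"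
    by (rule sum.reindex_bij_witness[of _ "\<lambda>j. Suc n - j" "\<lambda>j. Suc n - j"]) auto
  ultimately show ?thesis by (simp only: plane_coeff_eq[OF r] mult_ac)
qed

subsection \<open>Permanents along lines\<close>

lemma permanent_on_diagonal:
  assumes "finite I" "\<And>i j. i \<in> I \<Longrightarrow> j \<in> I \<Longrightarrow> i \<noteq> j \<Longrightarrow> M i j = 0"
  shows "permanent_on I M = (\<Prod>i\<in>I. M i i)"
proof -
  have "(\<Prod>i\<in>I. M i (\<sigma> i)) = 0" if \<sigma>: "\<sigma> permutes I" "\<sigma> \<noteq> id" for \<sigma>
  proof -
    obtain i where i: "\<sigma> i \<noteq> i" using \<sigma>(2) by (auto simp: fun_eq_iff)
    then have "i \<in> I" using \<sigma>(1) by (auto simp: permutes_def)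
    moreover have "M i (\<sigma> i) = 0"
      using i \<open>i \<in> I\<close> permutes_in_image[OF \<sigma>(1)] by (intro assms(2)) auto
    ultimately show ?thesis using assms(1) by (auto simp: prod_zero_iff)
  qed
  then have "permanent_on I M = (\<Sum>\<sigma>\<in>{id}. \<Prod>i\<in>I. M i (\<sigma> i))"
    unfolding permanent_on_def using assms(1)
    by (intro sum.mono_neutral_right) (auto simp: finite_permutations permutes_id)
  then show ?thesis by simp
qed

lemma prod_linear_polys:
  assumes "finite I"
  shows "Polynomial.degree (\<Prod>i\<in>I. [:a i, b i:]) \<le> card I"
    and "coeff (\<Prod>i\<in>I. [:a i, b i:]) (card I) = (\<Prod>i\<in>I. b i :: complex)"
proof -
  have "Polynomial.degree (\<Prod>i\<in>I. [:a i, b i:]) \<le> card I \<and>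
    coeff (\<Prod>i\<in>I. [:a i, b i:]) (card I) = (\<Prod>i\<in>I. b i)"
    using assms
  proof induction
    case (insert i I)
    have "Polynomial.degree ([:a i, b i:] * (\<Prod>i\<in>I. [:a i, b i:])) \<le> 1 + card I"
      using insert by (intro order.trans[OF degree_mult_le] add_mono) auto
    then show ?case using insert by (simp add: coeff_eq_0)
  qed simp
  then show "Polynomial.degree (\<Prod>i\<in>I. [:a i, b i:]) \<le> card I"
    "coeff (\<Prod>i\<in>I. [:a i, b i:]) (card I) = (\<Prod>i\<in>I. b i)" by auto
qed

lemma permanent_on_line:
  assumes "finite I"
  obtains H where "Polynomial.degree H \<le> card I" "coeff H (card I) = permanent_on I N"
    "\<And>\<theta>. poly H \<theta> = permanent_on I (\<lambda>i j. M i j + \<theta> * N i j)"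
proof
  let ?H = "\<Sum>\<sigma> | \<sigma> permutes I. \<Prod>i\<in>I. [:M i (\<sigma> i), N i (\<sigma> i):]"
  show "Polynomial.degree ?H \<le> card I"
    using assms by (intro degree_sum_le prod_linear_polys) (auto simp: finite_permutations)
  show "coeff ?H (card I) = permanent_on I N"
    unfolding coeff_sum permanent_on_def by (intro sum.cong refl prod_linear_polys(2) assms)
  show "poly ?H \<theta> = permanent_on I (\<lambda>i j. M i j + \<theta> * N i j)" for \<theta>
    unfolding permanent_on_def poly_sum poly_prod by simp
qed

subsection \<open>Polynomial curves\<close>

text \<open>The coefficients of the powers of t are themselves forms. A linear form on the space of
  forms, of which only additivity and homogeneity are known, can thus be applied term by term and
  gives a polynomial in t.\<close>

inductive_set poly_curves :: "nat \<Rightarrow> (complex \<Rightarrow> complex^'m^'m::finite \<Rightarrow> complex) set" for d where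
  monom: "c \<in> homog_polys d \<Longrightarrow> (\<lambda>t A. t ^ i * c A) \<in> poly_curves d"
| add: "f \<in> poly_curves d \<Longrightarrow> g \<in> poly_curves d \<Longrightarrow> (\<lambda>t A. f t A + g t A) \<in> poly_curves d"

lemma poly_curves_mem: "f \<in> poly_curves d \<Longrightarrow> f t \<in> homog_polys d"
  by (induction rule: poly_curves.induct) (auto intro: homog_polys_scale homog_polys_add)

lemma poly_curves_const: "c \<in> homog_polys d \<Longrightarrow> (\<lambda>t. c) \<in> poly_curves d"
  using poly_curves.monom[of c d 0] by simp

lemma poly_curves_sum:
  assumes "\<And>i. i \<in> I \<Longrightarrow> f i \<in> poly_curves d"
  shows "(\<lambda>t A. \<Sum>i\<in>I. f i t A) \<in> poly_curves d"
  using assms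
proof (induction I rule: infinite_finite_induct)
  case (insert i I)
  then have "(\<lambda>t A. f i t A + (\<Sum>i\<in>I. f i t A)) \<in> poly_curves d"
    by (intro poly_curves.add insert.IH) auto
  then show ?case using insert.hyps by simp
qed (simp_all add: poly_curves_const homog_polys_zero)

lemma poly_curves_mult:
  assumes "f \<in> poly_curves d" "g \<in> poly_curves d'"
  shows "(\<lambda>t A. f t A * g t A) \<in> poly_curves (d + d')"
  using assms(1)
proof induction
  case (monom c i)
  show ?case using assms(2)
  proof induction
    case (monom c' i')
    have "(\<lambda>t A. t ^ (i + i') * (c A * c' A)) \<in> poly_curves (d + d')"
      using monom \<open>c \<in> _\<close> by (intro poly_curves.monom homog_polys_mult)
    then show ?case by (simp add: power_add mult_ac)
  next
    case (add f g)
    then show ?case by (simp only: distrib_left poly_curves.add)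
  qed
next
  case (add f g)
  then show ?case by (simp only: distrib_right poly_curves.add)
qed

lemma poly_curves_prod:
  assumes "finite I" "\<And>i. i \<in> I \<Longrightarrow> f i \<in> poly_curves (d i)"
  shows "(\<lambda>t A. \<Prod>i\<in>I. f i t A) \<in> poly_curves (\<Sum>i\<in>I. d i)"
  using assms
proof (induction I rule: finite_induct)
  case empty
  then show ?case using poly_curves_const[OF homog_polys_one] by simp
next
  case (insert i I)
  then show ?case using poly_curves_mult[of "f i" "d i" "\<lambda>t A. \<Prod>i\<in>I. f i t A"] by simp
qed

lemma poly_curves_power:
  assumes "f \<in> poly_curves d"
  shows "(\<lambda>t A. f t A ^ k) \<in> poly_curves (k * d)"
proof (induction k)
  case 0
  then show ?case using poly_curves_const[OF homog_polys_one] by simp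
next
  case (Suc k)
  then show ?case using poly_curves_mult[OF assms Suc] by simp
qed

lemma poly_fun_on_poly_curve:
  assumes "F \<in> poly_funs fscale (homog_polys d)" "f \<in> poly_curves d"
  shows "\<exists>r. \<forall>t. F (f t) = poly r t"
  using assms(1)
proof induction
  case (const c)
  show ?case by (intro exI[of _ "[:c:]"]) simp
next
  case (linear F)
  show ?case using assms(2)
  proof induction
    case (monom c i)
    have "F (\<lambda>A. t ^ i * c A) = poly (Polynomial.monom (F c) i) t" for t
    proof -
      have "F (fscale (t ^ i) c) = t ^ i * F c"
        using linear monom unfolding linear_form_on_def by blast
      then show ?thesis by (simp add: fscale_def poly_monom)
    qed
    then show ?case by blast
  next
    case (add f g)
    then obtain r r' where r: "\<And>t. F (f t) = poly r t" "\<And>t. F (g t) = poly r' t" by blast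
    have "F (\<lambda>A. f t A + g t A) = poly (r + r') t" for t
    proof -
      have "F (f t + g t) = F (f t) + F (g t)"
        using linear add poly_curves_mem unfolding linear_form_on_def by blast
      then show ?thesis by (simp add: r plus_fun_def)
    qed
    then show ?case by blast
  qed
next
  case (add F G)
  then obtain r r' where "\<And>t. F (f t) = poly r t" "\<And>t. G (f t) = poly r' t" by blast
  then show ?case by (intro exI[of _ "r + r'"]) simp
next
  case (mult F G)
  then obtain r r' where "\<And>t. F (f t) = poly r t" "\<And>t. G (f t) = poly r' t" by blast
  then show ?case by (intro exI[of _ "r * r'"]) simp
qed

subsection \<open>The linear part of a polynomial function\<close>

text \<open>A Taylor expansion at the origin, by induction over the generators; the product case is
  the Leibniz rule. The constant and \<open>L\<close> serve all \<open>x\<close> at once, and only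
  the remainder depends on \<open>x\<close>.\<close>

lemma linear_part:
  assumes "f \<in> poly_funs s V"
  shows "\<exists>c L. linear_form_on s V L \<and>
    (\<forall>x\<in>V. \<exists>r. \<forall>t. f (s t x) = c + t * L x + t\<^sup>2 * poly r t)"
  using assms
proof induction
  case (const c)
  show ?case
  proof (intro exI conjI ballI allI)
    show "linear_form_on s V (\<lambda>_. 0)" by (simp add: linear_form_on_def)
    show "c = c + t * 0 + t\<^sup>2 * poly 0 t" for t by simp
  qed
next
  case (linear f)
  show ?case
  proof (intro exI conjI ballI allI)
    show "linear_form_on s V f" by fact
    show "f (s t x) = 0 + t * f x + t\<^sup>2 * poly 0 t" if "x \<in> V" for t x
      using linear that by (simp add: linear_form_on_def)
  qed
next
  case (add f g)
  then obtain c L c' L' where f: "linear_form_on s V L" "linear_form_on s V L'"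
    "\<And>x. x \<in> V \<Longrightarrow> \<exists>r. \<forall>t. f (s t x) = c + t * L x + t\<^sup>2 * poly r t"
    "\<And>x. x \<in> V \<Longrightarrow> \<exists>r. \<forall>t. g (s t x) = c' + t * L' x + t\<^sup>2 * poly r t" by blast
  have "\<exists>r. \<forall>t. f (s t x) + g (s t x) = (c + c') + t * (L x + L' x) + t\<^sup>2 * poly r t"
    if x: "x \<in> V" for x
  proof -
    obtain r r' where "\<And>t. f (s t x) = c + t * L x + t\<^sup>2 * poly r t"
      "\<And>t. g (s t x) = c' + t * L' x + t\<^sup>2 * poly r' t" using f(3,4)[OF x] by blast
    then show ?thesis by (intro exI[of _ "r + r'"]) (simp add: algebra_simps)
  qed
  moreover have "linear_form_on s V (\<lambda>x. L x + L' x)"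
    using f(1,2) by (simp add: linear_form_on_def algebra_simps)
  ultimately show ?case
    by (intro exI[of _ "c + c'"] exI[of _ "\<lambda>x. L x + L' x"]) simp
next
  case (mult f g)
  then obtain c L c' L' where f: "linear_form_on s V L" "linear_form_on s V L'"
    "\<And>x. x \<in> V \<Longrightarrow> \<exists>r. \<forall>t. f (s t x) = c + t * L x + t\<^sup>2 * poly r t"
    "\<And>x. x \<in> V \<Longrightarrow> \<exists>r. \<forall>t. g (s t x) = c' + t * L' x + t\<^sup>2 * poly r t" by blast
  have "\<exists>r. \<forall>t. f (s t x) * g (s t x) = c * c' + t * (c * L' x + c' * L x) + t\<^sup>2 * poly r t"
    if x: "x \<in> V" for x
  proof -
    obtain r r' where "\<And>t. f (s t x) = c + t * L x + t\<^sup>2 * poly r t"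
      "\<And>t. g (s t x) = c' + t * L' x + t\<^sup>2 * poly r' t" using f(3,4)[OF x] by blast
    then show ?thesis
      by (intro exI[of _ "[:c, L x:] * r' + [:c', L' x:] * r + [:L x * L' x:] + [:0, 0, 1:] * r * r'"])
         (simp add: algebra_simps power2_eq_square)
  qed
  moreover have "linear_form_on s V (\<lambda>x. c * L' x + c' * L x)"
    using f(1,2) by (simp add: linear_form_on_def algebra_simps)
  ultimately show ?case
    by (intro exI[of _ "c * c'"] exI[of _ "\<lambda>x. c * L' x + c' * L x"]) simp
qed

lemma linear_form_sum:
  assumes L: "linear_form_on fscale (homog_polys d) L" and q: "\<And>i. i \<in> I \<Longrightarrow> q i \<in> homog_polys d"
  shows "L (\<lambda>A. \<Sum>i\<in>I. c i * q i A) = (\<Sum>i\<in>I. c i * L (q i))"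
  using q
proof (induction I rule: infinite_finite_induct)
  case (insert i I)
  have mem: "(\<lambda>A. c i * q i A) \<in> homog_polys d" "(\<lambda>A. \<Sum>i\<in>I. c i * q i A) \<in> homog_polys d"
    using insert.prems by (auto intro!: homog_polys_scale homog_polys_sum)
  have "L (\<lambda>A. \<Sum>i\<in>insert i I. c i * q i A) = L ((\<lambda>A. c i * q i A) + (\<lambda>A. \<Sum>i\<in>I. c i * q i A))"
    using insert.hyps by (simp add: plus_fun_def)
  also have "\<dots> = L (\<lambda>A. c i * q i A) + L (\<lambda>A. \<Sum>i\<in>I. c i * q i A)"
    using L mem unfolding linear_form_on_def by blast
  also have "L (\<lambda>A. c i * q i A) = c i * L (q i)"
  proof -
    have "L (fscale (c i) (q i)) = c i * L (q i)"
      using L insert.prems unfolding linear_form_on_def by blast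
    then show ?thesis by (simp add: fscale_def)
  qed
  finally show ?case using insert by simp
next
  case (infinite I)
  have "L (fscale 0 (\<lambda>_. 0)) = 0 * L (\<lambda>_. 0)"
    using L homog_polys_zero unfolding linear_form_on_def by blast
  then show ?case using infinite by (simp add: fscale_def)
next
  case empty
  have "L (fscale 0 (\<lambda>_. 0)) = 0 * L (\<lambda>_. 0)"
    using L homog_polys_zero unfolding linear_form_on_def by blast
  then show ?case by (simp add: fscale_def)
qed

lemma poly_zero_off_point_imp_zero:
  fixes r :: "complex poly"
  assumes "\<And>t. t \<noteq> c \<Longrightarrow> poly r t = 0"
  shows "r = 0"
proof (rule ccontr)
  assume "r \<noteq> 0"
  moreover have "- {c} \<subseteq> {t. poly r t = 0}" using assms by auto
  moreover have "infinite (- {c})" by (simp add: infinite_UNIV_char_0 finite_compl)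
  ultimately show False using poly_roots_finite finite_subset by blast
qed

subsection \<open>Elements of the orbit\<close>

lemma vector_space_mscale: "vector_space (mscale :: complex \<Rightarrow> complex^'m^'m \<Rightarrow> complex^'m^'m)"
  by unfold_locales (simp_all add: vec_eq_iff algebra_simps)

lemma linear_mscale_iff:
  "Vector_Spaces.linear mscale mscale (T :: complex^'m^'m \<Rightarrow> complex^'m^'m) \<longleftrightarrow>
    (\<forall>x y. T (x + y) = T x + T y) \<and> (\<forall>c x. T (mscale c x) = mscale c (T x))"
  by (simp add: Vector_Spaces.linear_iff vector_space_mscale)

lemma linear_inv_GL:
  assumes "g \<in> GL"
  shows "Vector_Spaces.linear mscale mscale (inv_into UNIV g)"
proof -
  have lin: "g (x + y) = g x + g y" "g (mscale c x) = mscale c (g x)" and bij: "bij g" for x y c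
    using assms by (auto simp: GL_def linear_mscale_iff)
  have g: "inv_into UNIV g (g A) = A" "g (inv_into UNIV g A) = A" for A
    using bij by (auto simp: bij_is_inj bij_is_surj surj_f_inv_f)
  have "inv_into UNIV g (A + B) = inv_into UNIV g A + inv_into UNIV g B" for A B
    using g(1)[of "inv_into UNIV g A + inv_into UNIV g B"] by (simp add: lin g(2))
  moreover have "inv_into UNIV g (mscale c A) = mscale c (inv_into UNIV g A)" for c A
    using g(1)[of "mscale c (inv_into UNIV g A)"] by (simp add: lin g(2))
  ultimately show ?thesis by (simp add: linear_mscale_iff)
qed

text \<open>Vanishing on diagonal matrices makes a map into diagonal matrices with such components
  square to zero, so adding it to a nonzero scalar gives explicit invertible maps. On a diagonal
  matrix the permanent is a product, hence such maps realize products of prescribed linear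
  forms.\<close>

definition offdiag_form :: "(complex^'m^'m \<Rightarrow> complex) \<Rightarrow> bool" where
  "offdiag_form \<phi> \<longleftrightarrow> (\<forall>x y. \<phi> (x + y) = \<phi> x + \<phi> y) \<and> (\<forall>c x. \<phi> (mscale c x) = c * \<phi> x) \<and>
     (\<forall>D. (\<forall>i j. i \<noteq> j \<longrightarrow> D $ i $ j = 0) \<longrightarrow> \<phi> D = 0)"

lemma offdiag_form_entry: "i \<noteq> j \<Longrightarrow> offdiag_form (\<lambda>x. x $ i $ j)"
  by (simp add: offdiag_form_def)

lemma offdiag_form_zero: "offdiag_form (\<lambda>x. 0)"
  by (simp add: offdiag_form_def)

lemma offdiag_form_scale: "offdiag_form \<phi> \<Longrightarrow> offdiag_form (\<lambda>x. c * \<phi> x)"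
  by (simp add: offdiag_form_def algebra_simps)

lemma offdiag_form_add: "offdiag_form \<phi> \<Longrightarrow> offdiag_form \<psi> \<Longrightarrow> offdiag_form (\<lambda>x. \<phi> x + \<psi> x)"
  by (simp add: offdiag_form_def algebra_simps)

definition diag_map :: "('m \<Rightarrow> complex^'m^'m \<Rightarrow> complex) \<Rightarrow> complex^'m^'m \<Rightarrow> complex^'m^'m" where
  "diag_map \<Lambda> x = (\<chi> i j. if i = j then \<Lambda> i x else 0)"

lemma diag_map_nth [simp]: "diag_map \<Lambda> x $ i $ j = (if i = j then \<Lambda> i x else 0)"
  by (simp add: diag_map_def)

lemma linear_diag_map:
  assumes "\<And>i. offdiag_form (\<Lambda> i)"
  shows "Vector_Spaces.linear mscale mscale (\<lambda>x. mscale c x + diag_map \<Lambda> x)"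
  using assms by (auto simp: linear_mscale_iff offdiag_form_def vec_eq_iff algebra_simps)

text \<open>The map \<open>x \<mapsto> c x + L x\<close> is invertible because \<open>L\<close> squares to zero.\<close>

lemma act_square_zero:
  assumes \<Lambda>: "\<And>i. offdiag_form (\<Lambda> i)" and c: "c \<noteq> 0"
  shows "(\<lambda>A. q (mscale c A + diag_map \<Lambda> A)) \<in> (\<lambda>g. act g q) ` GL"
proof -
  \<comment> \<open>If L^2 = 0, the inverse of c + L is 1/c - L/c^2. The action composes with the
    inverse of \<open>g\<close>, so \<open>g\<close> has to be this inverse.\<close>
  define g where "g = (\<lambda>x. mscale (1 / c) x + diag_map (\<lambda>i x. (- 1 / c\<^sup>2) * \<Lambda> i x) x)"
  let ?h = "\<lambda>x. mscale c x + diag_map \<Lambda> x"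
  have lin: "\<Lambda> i (x + y) = \<Lambda> i x + \<Lambda> i y" "\<Lambda> i (mscale d x) = d * \<Lambda> i x" "\<Lambda> i (diag_map \<Gamma> x) = 0"
    for i x y d \<Gamma>
    using \<Lambda>[of i] by (auto simp: offdiag_form_def)
  have gh: "g (?h x) = x" "?h (g x) = x" for x
    using c by (simp_all add: g_def lin vec_eq_iff field_simps power2_eq_square)
  have bij: "bij g" by (rule bij_betw_byWitness[of UNIV ?h]) (auto simp: gh)
  have "inv_into UNIV g = ?h" by (rule inv_unique_comp) (auto simp: gh)
  moreover have "g \<in> GL"
    unfolding GL_def g_def[symmetric] using bij unfolding g_def
    by (intro CollectI conjI linear_diag_map offdiag_form_scale \<Lambda>)
  ultimately show ?thesis unfolding act_def by (intro image_eqI[of _ _ g]) auto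
qed

section \<open>The padded permanent: restriction to lines and integrality\<close>

locale padded_permanent =
  fixes e :: "nat \<Rightarrow> 'm::finite" and m n k :: nat
  assumes card: "m = CARD('m)" and bij: "bij_betw e {1..m} UNIV"
    and n: "n \<ge> 3" and m: "m \<ge> 2 * n" and k: "k = m - n"
begin

abbreviation "B \<equiv> {k + 1..m}"
abbreviation "p \<equiv> padded_perm e n"
abbreviation "Q \<equiv> homog_polys m :: (complex^'m^'m \<Rightarrow> complex) set"
abbreviation "lin \<equiv> Vector_Spaces.linear mscale mscale :: (complex^'m^'m \<Rightarrow> complex^'m^'m) \<Rightarrow> bool"
abbreviation "corner (x :: complex^'m^'m) \<equiv> x $ e 1 $ e 1"
abbreviation "per (x :: complex^'m^'m) \<equiv> permanent_on B (\<lambda>i j. x $ e i $ e j)"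
abbreviation "orbit \<equiv> (\<lambda>g. act g p) ` GL"

lemma kn: "n \<le> k" "k + n = m" "k \<ge> 3" using n m k by auto

lemma card_B: "card B = n" using kn by simp

lemma p_eq: "p x = corner x ^ k * per x"
  using k card by (simp add: padded_perm_def)

lemma e_eq: "1 \<le> i \<Longrightarrow> i \<le> m \<Longrightarrow> 1 \<le> j \<Longrightarrow> j \<le> m \<Longrightarrow> e i = e j \<longleftrightarrow> i = j"
  using inj_on_eq_iff[OF bij_betw_imp_inj_on[OF bij], of i j] by simp

lemma p_linear_in_Q: "lin T \<Longrightarrow> (\<lambda>A. p (T A)) \<in> Q"
  using padded_perm_in_homog_polys[of n e] kn(2) unfolding card[symmetric]
  by (simp add: homog_polys_linear_comp)

lemma orbit_subset_Q: "orbit \<subseteq> Q"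
  using orbit_subset_homog_polys[of n e] kn(2) unfolding card[symmetric] by simp

text \<open>Here l is \<open>corner\<close> after \<open>T\<close> and h is \<open>per\<close> after
  \<open>T\<close>; \<open>H\<close> is h along the line, and its coefficient n is the value of h at
  the direction.\<close>

lemma p_on_line:
  assumes T: "lin T"
  obtains H where "Polynomial.degree H \<le> n" "coeff H n = per (T y)"
    "\<And>\<theta>. p (T (x + mscale \<theta> y)) = poly ([:corner (T x), corner (T y):] ^ k * H) \<theta>"
proof -
  have lin: "T (x + mscale \<theta> y) = T x + mscale \<theta> (T y)" for \<theta>
    using T by (simp add: linear_mscale_iff)
  obtain H where H: "Polynomial.degree H \<le> n" "coeff H n = per (T y)"
    "\<And>\<theta>. poly H \<theta> = permanent_on B (\<lambda>i j. T x $ e i $ e j + \<theta> * T y $ e i $ e j)"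
    using permanent_on_line[of B "\<lambda>i j. T y $ e i $ e j" "\<lambda>i j. T x $ e i $ e j"] card_B by auto
  show thesis
    by (rule that[OF H(1,2)]) (simp_all add: lin H(3) p_eq)
qed

text \<open>The direction \<open>y\<close> lies in the kernel of the linear factor, so along it only the permanent varies.\<close>

lemma p_relation:
  assumes T: "lin T"
  shows "(\<Sum>j\<le>Suc n. plane_coeff x v w (Suc n - j) j (\<lambda>A. p (T A)) *
    (corner (T w) ^ (Suc n - j) * (- corner (T v)) ^ j)) = 0"
proof -
  define a b where "a = corner (T v)" "b = corner (T w)"
  define y where "y = mscale b v + mscale (- a) w"
  obtain H where H: "Polynomial.degree H \<le> n"
    "\<And>\<theta>. p (T (x + mscale \<theta> y)) = poly ([:corner (T x), corner (T y):] ^ k * H) \<theta>"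
    using p_on_line[OF T, of y x] by metis
  have y0: "corner (T y) = 0" using T by (simp add: y_def a_b_def linear_mscale_iff)
  have eq: "x + mscale (b * \<theta>) v + mscale (- a * \<theta>) w = x + mscale \<theta> y" for \<theta>
    by (simp add: y_def vec_eq_iff algebra_simps)
  have val: "p (T (x + mscale (b * \<theta>) v + mscale (- a * \<theta>) w)) = poly (Polynomial.smult (corner (T x) ^ k) H) \<theta>"
    for \<theta> unfolding eq H(2) y0 by simp
  show ?thesis
    unfolding a_b_def[symmetric]
    by (rule plane_coeff_relation[OF p_linear_in_Q[OF T] _ val])
       (rule order.trans[OF degree_smult_le H(1)])
qed

text \<open>Along v + theta w the linear factor contributes theta^k, which kills all coefficients
  below k, and n - 1 < k. This coefficient therefore serves as a factor of the denominator that
  vanishes wherever l(v) = 0.\<close>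

lemma p_low_coeff:
  assumes T: "lin T" and "corner (T v) = 0"
  shows "plane_coeff v w 0 (n - 1) 0 (\<lambda>A. p (T A)) = 0"
proof -
  obtain H where H: "\<And>\<theta>. p (T (v + mscale \<theta> w)) = poly ([:corner (T v), corner (T w):] ^ k * H) \<theta>"
    using p_on_line[OF T, of w v] by metis
  have eq: "[:corner (T v), corner (T w):] ^ k * H = Polynomial.monom (corner (T w) ^ k) k * H"
  proof -
    have "[:0, c:] ^ k = Polynomial.monom (c ^ k) k" for c :: complex
      using monom_power[of c 1 k] by (simp add: monom_altdef)
    then show ?thesis by (simp only: assms(2))
  qed
  have "plane_coeff v w 0 (n - 1) 0 (\<lambda>A. p (T A)) = coeff (Polynomial.monom (corner (T w) ^ k) k * H) (n - 1)"
    by (rule plane_coeff_line) (simp only: H eq)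
  then show ?thesis using kn n by (simp add: coeff_monom_mult)
qed

lemma p_line_coeffs:
  assumes T: "lin T"
  obtains H where "Polynomial.degree H \<le> n" "coeff H n = per (T v)"
    "\<And>j. plane_coeff w v 0 j 0 (\<lambda>A. p (T A)) = coeff ([:corner (T w), corner (T v):] ^ k * H) j"
proof -
  obtain H where H: "Polynomial.degree H \<le> n" "coeff H n = per (T v)"
    "\<And>\<theta>. p (T (w + mscale \<theta> v)) = poly ([:corner (T w), corner (T v):] ^ k * H) \<theta>"
    using p_on_line[OF T, of v w] by metis
  show thesis by (rule that[OF H(1,2)]) (intro plane_coeff_line H(3))
qed

lemma orbit_cases:
  assumes "q \<in> orbit"
  obtains T where "lin T" "q = (\<lambda>A. p (T A))"
  using assms linear_inv_GL by (auto simp: act_def)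

text \<open>The monomials of degree D in a = l(v), b = l(w) form a vector with eigenvalue F for a
  matrix \<open>r\<close> linear in q, and \<open>M\<close> is z - r. Monic elimination leaves P(F)
  times the last monomial a^D, which can be cancelled because l(v) is nonzero.\<close>

lemma p_integral:
  "\<exists>P d. coeffs_in fscale Q P \<and> (\<forall>q. monic_upto d 1 (P q)) \<and>
     (\<forall>T. lin T \<longrightarrow> corner (T v) \<noteq> 0 \<longrightarrow> poly (P (\<lambda>A. p (T A))) (corner (T w) ^ k * per (T v)) = 0)"
proof -
  define D where "D = k * Suc n"
  obtain \<kappa> :: "nat \<Rightarrow> nat \<Rightarrow> nat \<Rightarrow> complex" where
    \<kappa>: "\<And>f a b H. f \<le> D \<Longrightarrow> Polynomial.degree H \<le> n \<Longrightarrow> b ^ k * coeff H n * (a ^ f * b ^ (D - f)) =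
      (\<Sum>g\<le>D. (\<Sum>j\<le>k + n. \<kappa> f g j * coeff ([:b, a:] ^ k * H) j) * (a ^ g * b ^ (D - g)))"
    using leading_coeff_relation[OF kn(1) D_def] by blast
  define r where "r f g q = (\<Sum>j\<le>k + n. \<kappa> f g j * plane_coeff w v 0 j 0 q)" for f g q
  define M where "M f g = (\<lambda>q. [:- r f g q, if f = g then 1 else 0:])" for f g :: nat
  have r: "r f g \<in> poly_funs fscale Q" for f g
    unfolding r_def[abs_def]
    by (intro poly_funs_sum poly_funs.mult poly_funs.const plane_coeff_poly_funs)
  have "coeffs_in fscale Q (M f g)" for f g
    unfolding coeffs_in_def
  proof
    fix i
    show "(\<lambda>q. coeff (M f g q) i) \<in> poly_funs fscale Q"
    proof (cases i)
      case 0
      then show ?thesis using poly_funs_uminus[OF r[of f g]] by (simp add: M_def)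
    next
      case (Suc j)
      then show ?thesis by (cases j) (simp_all add: M_def poly_funs.const)
    qed
  qed
  moreover have "monic_upto 1 (if f = g then 1 else 0) (M f g q)" for f g q
    by (auto simp: monic_upto_def M_def coeff_pCons split: nat.splits)
  ultimately obtain P d where P: "coeffs_in fscale Q P" "\<And>q. monic_upto d 1 (P q)"
    "\<And>q z \<nu>. (\<forall>i\<le>D. (\<Sum>j\<le>D. poly (M i j q) z * \<nu> j) = 0) \<Longrightarrow> poly (P q) z * \<nu> D = 0"
    using monic_elimination[of D fscale Q M 1] by auto
  have "poly (P (\<lambda>A. p (T A))) (corner (T w) ^ k * per (T v)) = 0" if T: "lin T" "corner (T v) \<noteq> 0" for T
  proof -
    define a b where "a = corner (T v)" "b = corner (T w)"
    obtain H where H: "Polynomial.degree H \<le> n" "coeff H n = per (T v)"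
      "\<And>j. plane_coeff w v 0 j 0 (\<lambda>A. p (T A)) = coeff ([:b, a:] ^ k * H) j"
      using p_line_coeffs[OF T(1), of v w] unfolding a_b_def by metis
    let ?\<nu> = "\<lambda>f. a ^ f * b ^ (D - f)"
    have "poly (P (\<lambda>A. p (T A))) (b ^ k * coeff H n) * ?\<nu> D = 0"
    proof (rule P(3)[of _ _ ?\<nu>], intro allI impI)
      fix f assume f: "f \<le> D"
      have "(\<Sum>g\<le>D. poly (M f g (\<lambda>A. p (T A))) (b ^ k * coeff H n) * ?\<nu> g)
        = (\<Sum>g\<le>D. (if g = f then b ^ k * coeff H n * ?\<nu> g else 0) - r f g (\<lambda>A. p (T A)) * ?\<nu> g)"
        by (intro sum.cong refl) (auto simp: M_def algebra_simps)
      also have "\<dots> = b ^ k * coeff H n * ?\<nu> f - (\<Sum>g\<le>D. r f g (\<lambda>A. p (T A)) * ?\<nu> g)"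
        using f by (simp add: sum_subtractf)
      also have "\<dots> = 0" unfolding \<kappa>[OF f H(1)] r_def H(3) by simp
      finally show "(\<Sum>g\<le>D. poly (M f g (\<lambda>A. p (T A))) (b ^ k * coeff H n) * ?\<nu> g) = 0" .
    qed
    then show ?thesis using T(2) by (simp add: H(2) a_b_def)
  qed
  with P(1,2) show ?thesis by blast
qed

text \<open>Either alternative removes the scalar part from the corner and from the rows of the
  block; what remains there is diagonal, so the permanent is the product of its diagonal.\<close>

lemma p_diag_map:
  assumes "c = 0 \<or> A $ e 1 $ e 1 = 0 \<and> (\<forall>i\<in>B. \<forall>\<beta>. A $ e i $ \<beta> = 0)"
  shows "p (mscale c A + diag_map \<Lambda> A) = \<Lambda> (e 1) A ^ k * (\<Prod>i\<in>B. \<Lambda> (e i) A)"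
proof -
  have "per (mscale c A + diag_map \<Lambda> A) = (\<Prod>i\<in>B. (mscale c A + diag_map \<Lambda> A) $ e i $ e i)"
    using assms by (intro permanent_on_diagonal) (auto simp: e_eq)
  also have "\<dots> = (\<Prod>i\<in>B. \<Lambda> (e i) A)"
    using assms by (intro prod.cong) auto
  finally show ?thesis using assms by (auto simp: p_eq)
qed

lemma p_curve:
  assumes "lin T" "lin Y"
  shows "(\<lambda>t A. p (T A + mscale t (Y A))) \<in> poly_curves m"
proof -
  have entry: "(\<lambda>t A. (T A + mscale t (Y A)) $ i $ j) \<in> poly_curves 1" for i j
  proof -
    have "(\<lambda>t A. t ^ 0 * (T A $ i $ j) + t ^ 1 * (Y A $ i $ j)) \<in> poly_curves 1"
      by (intro poly_curves.add poly_curves.monom homog_polys_linear_comp[OF assms(1)]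
          homog_polys_linear_comp[OF assms(2)] homog_polys_entry)
    then show ?thesis by simp
  qed
  have "(\<lambda>t A. \<Prod>i\<in>B. (T A + mscale t (Y A)) $ e i $ e (\<sigma> i)) \<in> poly_curves (\<Sum>i\<in>B. 1)" for \<sigma>
    by (intro poly_curves_prod entry) auto
  then have "(\<lambda>t A. per (T A + mscale t (Y A))) \<in> poly_curves n"
    unfolding permanent_on_def sum_constant card_B by (intro poly_curves_sum) simp
  from poly_curves_mult[OF poly_curves_power[OF entry[of "e 1" "e 1"], of k] this]
  show ?thesis using kn by (simp add: p_eq)
qed

subsection \<open>A point of the orbit with nonvanishing denominator\<close>

text \<open>\<open>v\<close> and \<open>w\<close> are off-diagonal unit matrices in the first row:
  their dual coordinates are of type \<open>offdiag_form\<close>, and a scalar multiple of them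
  meets neither the corner nor the block.\<close>

definition v :: "complex^'m^'m" where "v = (\<chi> \<alpha> \<beta>. if \<alpha> = e 1 \<and> \<beta> = e 2 then 1 else 0)"
definition w :: "complex^'m^'m" where "w = (\<chi> \<alpha> \<beta>. if \<alpha> = e 1 \<and> \<beta> = e 3 then 1 else 0)"

text \<open>The base point has h equal to a product of n linear factors whose values are adjustable
  separately through the second row. The extra x12 in the last factor turns the base point along v +
  theta w into theta^(n-1) (1 + theta), with coefficient 1 at n - 1; without it this coefficient
  would be zero.\<close>

definition base_forms :: "'m \<Rightarrow> complex^'m^'m \<Rightarrow> complex" where
  "base_forms \<alpha> x = (if \<alpha> = e 1 then x $ e 1 $ e 2
     else if \<alpha> \<in> e ` B then x $ e 1 $ e 3 + x $ e 2 $ \<alpha> + (if \<alpha> = e m then x $ e 1 $ e 2 else 0)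
     else 0)"

definition base :: "complex^'m^'m \<Rightarrow> complex^'m^'m" where
  "base A = mscale 1 A + diag_map base_forms A"

text \<open>Chosen such that the coefficient of \<open>\<sigma>\<^sup>2\<close> in \<open>(1 + \<sigma>)\<^sup>k (shift n + \<sigma>)\<close> vanishes.\<close>

definition shift :: "nat \<Rightarrow> complex" where
  "shift i = (if i = n then - 2 / (of_nat k - 1) else 0)"

text \<open>The restrictions of the base point to the planes through these points give a triangular system.\<close>

definition probe :: "nat \<Rightarrow> complex^'m^'m" where
  "probe i = (\<chi> \<alpha> \<beta>. if \<alpha> = e 1 \<and> \<beta> = e 2 then 1 else if \<alpha> = e 2 then
     (if \<beta> = e m then shift i - 1 else if \<beta> \<in> e ` {k + i + 1..m - 1} then 1 else 0) else 0)"

lemma e_distinct: "e 1 \<noteq> e 2" "e 1 \<noteq> e 3" "e 2 \<noteq> e 3"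
  "i \<in> B \<Longrightarrow> e i \<noteq> e 1" "i \<in> B \<Longrightarrow> e i \<noteq> e 2" "i \<in> B \<Longrightarrow> e i \<noteq> e 3"
  using kn n by (auto simp: e_eq)

lemma e_image: "i \<in> {1..m} \<Longrightarrow> I \<subseteq> {1..m} \<Longrightarrow> e i \<in> e ` I \<longleftrightarrow> i \<in> I"
  using inj_on_image_mem_iff[OF bij_betw_imp_inj_on[OF bij], of i I] by blast

lemma offdiag_base_forms: "offdiag_form (base_forms \<alpha>)"
proof -
  have "\<alpha> \<noteq> e 2" if "\<alpha> \<in> e ` B" using that e_distinct(5) by auto
  then consider "\<alpha> = e 1" | "\<alpha> \<noteq> e 1" "\<alpha> \<in> e ` B" "\<alpha> \<noteq> e 2" | "\<alpha> \<noteq> e 1" "\<alpha> \<notin> e ` B" by blast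
  then show ?thesis
  proof cases
    case 2
    have "offdiag_form (\<lambda>x. x $ e 1 $ e 3 + x $ e 2 $ \<alpha> + (if \<alpha> = e m then x $ e 1 $ e 2 else 0))"
      using e_distinct 2(3)
      by (cases "\<alpha> = e m") (auto intro!: offdiag_form_add offdiag_form_entry offdiag_form_zero)
    then show ?thesis using 2 by (simp add: base_forms_def[abs_def])
  qed (use e_distinct in \<open>simp_all add: base_forms_def[abs_def] offdiag_form_entry offdiag_form_zero\<close>)
qed

lemma lin_base: "lin base"
  unfolding base_def[abs_def] by (intro linear_diag_map offdiag_base_forms)

lemma p_base:
  assumes "A $ e 1 $ e 1 = 0" "\<And>\<alpha> \<beta>. \<alpha> \<noteq> e 1 \<Longrightarrow> \<alpha> \<noteq> e 2 \<Longrightarrow> A $ \<alpha> $ \<beta> = 0"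
  shows "p (base A) = (A $ e 1 $ e 2) ^ k *
    ((A $ e 1 $ e 3 + A $ e 2 $ e m + A $ e 1 $ e 2) * (\<Prod>i\<in>{k + 1..m - 1}. A $ e 1 $ e 3 + A $ e 2 $ e i))"
proof -
  have "p (base A) = base_forms (e 1) A ^ k * (\<Prod>i\<in>B. base_forms (e i) A)"
    unfolding base_def using assms e_distinct by (intro p_diag_map) auto
  also have "base_forms (e 1) A = A $ e 1 $ e 2" by (simp add: base_forms_def)
  also have "(\<Prod>i\<in>B. base_forms (e i) A)
    = (\<Prod>i\<in>B. A $ e 1 $ e 3 + A $ e 2 $ e i + (if i = m then A $ e 1 $ e 2 else 0))"
  proof (intro prod.cong refl)
    fix i assume i: "i \<in> B"
    then have "e i = e m \<longleftrightarrow> i = m" by (intro e_eq) auto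
    then show "base_forms (e i) A = A $ e 1 $ e 3 + A $ e 2 $ e i + (if i = m then A $ e 1 $ e 2 else 0)"
      using i e_distinct(4)[OF i] by (simp add: base_forms_def)
  qed
  also have "B = insert m {k + 1..m - 1}" using kn n by auto
  also have "(\<Prod>i\<in>insert m {k + 1..m - 1}. A $ e 1 $ e 3 + A $ e 2 $ e i + (if i = m then A $ e 1 $ e 2 else 0))
    = (A $ e 1 $ e 3 + A $ e 2 $ e m + A $ e 1 $ e 2) * (\<Prod>i\<in>{k + 1..m - 1}. A $ e 1 $ e 3 + A $ e 2 $ e i)"
  proof -
    have "m \<notin> {k + 1..m - 1}" using kn n by auto
    moreover have "(\<Prod>i\<in>{k + 1..m - 1}. A $ e 1 $ e 3 + A $ e 2 $ e i + (if i = m then A $ e 1 $ e 2 else 0))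
      = (\<Prod>i\<in>{k + 1..m - 1}. A $ e 1 $ e 3 + A $ e 2 $ e i)"
      using kn n by (intro prod.cong) auto
    ultimately show ?thesis by simp
  qed
  finally show ?thesis .
qed

lemma base_low_coeff: "plane_coeff v w 0 (n - 1) 0 (\<lambda>A. p (base A)) = 1"
proof -
  have "p (base (v + mscale \<theta> w)) = poly (Polynomial.monom 1 (n - 1) * [:1, 1:]) \<theta>" for \<theta>
  proof -
    have "p (base (v + mscale \<theta> w)) = 1 ^ k * ((\<theta> + 0 + 1) * (\<Prod>i\<in>{k + 1..m - 1}. \<theta> + 0))"
      using e_distinct by (subst p_base) (auto simp: v_def w_def)
    also have "card {k + 1..m - 1} = n - 1" using kn by simp
    then have "(\<Prod>i\<in>{k + 1..m - 1}. \<theta> + 0) = \<theta> ^ (n - 1)" by simp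
    finally show ?thesis by (simp add: poly_monom algebra_simps)
  qed
  then have "plane_coeff v w 0 (n - 1) 0 (\<lambda>A. p (base A)) = coeff (Polynomial.monom 1 (n - 1) * [:1, 1:]) (n - 1)"
    by (rule plane_coeff_line)
  then show ?thesis by (simp only: coeff_monom_mult) simp
qed

text \<open>The entry \<open>shift i - 1\<close> of the probe offsets the 1 that x12 adds to the
  last factor. Of the other n - 1 factors, those up to index k + i become \<tau> and the rest 1 +
  \<tau>; \<open>min\<close> accounts for i = n.\<close>

lemma p_base_probe:
  assumes "i \<le> n"
  shows "p (base (probe i + mscale \<sigma> v + mscale \<tau> w)) =
    (1 + \<sigma>) ^ k * ((\<tau> + shift i + \<sigma>) * (\<tau> ^ min i (n - 1) * (1 + \<tau>) ^ (n - 1 - i)))"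
proof -
  let ?A = "probe i + mscale \<sigma> v + mscale \<tau> w"
  have "(\<Prod>r\<in>{k + 1..m - 1}. ?A $ e 1 $ e 3 + ?A $ e 2 $ e r)
    = (\<Prod>r\<in>{k + 1..m - 1}. if k + i < r then 1 + \<tau> else \<tau>)"
  proof (intro prod.cong refl)
    fix r assume r: "r \<in> {k + 1..m - 1}"
    then have "e r \<noteq> e m" using kn n by (subst e_eq) auto
    moreover have "e r \<in> e ` {k + i + 1..m - 1} \<longleftrightarrow> k + i < r"
      using r kn n by (subst e_image) auto
    ultimately show "?A $ e 1 $ e 3 + ?A $ e 2 $ e r = (if k + i < r then 1 + \<tau> else \<tau>)"
      using e_distinct by (auto simp: probe_def v_def w_def)
  qed
  also have "\<dots> = \<tau> ^ min i (n - 1) * (1 + \<tau>) ^ (n - 1 - i)"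
  proof -
    have "{k + 1..m - 1} \<inter> {r. k + i < r} = {k + i + 1..m - 1}"
      "{k + 1..m - 1} \<inter> - {r. k + i < r} = {k + 1..k + min i (n - 1)}"
      using kn n by auto
    moreover have "card {k + i + 1..m - 1} = n - 1 - i" using kn by simp
    ultimately show ?thesis by (subst prod.If_cases) (simp_all add: mult.commute)
  qed
  finally have prod: "(\<Prod>r\<in>{k + 1..m - 1}. ?A $ e 1 $ e 3 + ?A $ e 2 $ e r)
    = \<tau> ^ min i (n - 1) * (1 + \<tau>) ^ (n - 1 - i)" .
  have "?A $ e 1 $ e 1 = 0" "\<And>\<alpha> \<beta>. \<alpha> \<noteq> e 1 \<Longrightarrow> \<alpha> \<noteq> e 2 \<Longrightarrow> ?A $ \<alpha> $ \<beta> = 0"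
    "?A $ e 1 $ e 2 = 1 + \<sigma>" "?A $ e 1 $ e 3 + ?A $ e 2 $ e m + ?A $ e 1 $ e 2 = \<tau> + shift i + \<sigma>"
    using e_distinct by (auto simp: probe_def v_def w_def)
  then show ?thesis using p_base[of ?A] unfolding prod by simp
qed

lemma probe_coeff:
  assumes "i \<le> n"
  defines "G \<equiv> Polynomial.monom 1 (min i (n - 1)) * [:1, 1:] ^ (n - 1 - i) :: complex poly"
  shows "plane_coeff (probe i) v w l j (\<lambda>A. p (base A)) =
    coeff ([:1, 1:] ^ k * [:shift i, 1:]) l * coeff G j + coeff ([:1, 1:] ^ k) l * coeff (pCons 0 G) j"
  by (intro plane_coeff_products, subst p_base_probe[OF assms(1)])
     (simp add: G_def poly_monom algebra_simps)

lemma coeff_one_plus_power: "coeff ([:1, 1:] ^ k :: complex poly) l = of_nat (k choose l)"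
proof (cases "l \<le> k")
  case False
  have "Polynomial.degree ([:1, 1:] ^ k :: complex poly) \<le> k"
    using degree_power_le[of "[:1, 1:] :: complex poly" k] by simp
  then show ?thesis using False by (simp add: coeff_eq_0 binomial_eq_0)
qed (simp add: coeff_linear_poly_power)

lemma coeff_one_plus_power_mult:
  "coeff ([:1, 1:] ^ k * [:c, 1:] :: complex poly) (Suc l) = c * of_nat (k choose Suc l) + of_nat (k choose l)"
  by (simp add: coeff_one_plus_power[symmetric])

text \<open>In row i the factor \<open>G\<close> starts at \<tau>^min(i, n - 1) with coefficient 1,
  so earlier columns vanish; for i < n the diagonal entry is binom(k, n - i). The last row is
  exceptional: its \<open>G\<close> also starts at \<tau>^(n-1), the entry in column n - 1 is
  removed by the choice of \<open>shift n\<close>, and the diagonal entry k comes from the summand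
  \<tau> \<open>G\<close>.\<close>

lemma probe_triangular:
  assumes "i \<le> n"
  shows "j < i \<Longrightarrow> plane_coeff (probe i) v w (Suc n - j) j (\<lambda>A. p (base A)) = 0"
    and "plane_coeff (probe i) v w (Suc n - i) i (\<lambda>A. p (base A)) \<noteq> 0"
proof -
  let ?G = "Polynomial.monom 1 (min i (n - 1)) * [:1, 1:] ^ (n - 1 - i) :: complex poly"
  have low: "coeff ?G j = 0" if "j < min i (n - 1)" for j using that by (simp add: coeff_monom_mult)
  have diag: "coeff ?G (min i (n - 1)) = 1"
    by (simp add: coeff_monom_mult coeff_0_power)
  have sh: "coeff (pCons 0 P) j = (if j = 0 then 0 else coeff P (j - 1))" for P :: "complex poly" and j
    by (cases j) auto
  have pow: "Suc n - j = Suc (n - j)" if "j \<le> n" for j using that by simp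
  show "plane_coeff (probe i) v w (Suc n - j) j (\<lambda>A. p (base A)) = 0" if j: "j < i"
  proof (cases "j < min i (n - 1)")
    case True
    have "j - 1 < min i (n - 1)" using True by arith
    then have "coeff (pCons 0 ?G) j = 0" unfolding sh by (simp only: low) simp
    then show ?thesis using low[OF True] by (simp only: probe_coeff[OF assms]) simp
  next
    case False
    then have ij: "i = n" "j = n - 1" using j assms by auto
    have "j - 1 < min i (n - 1)" using ij n by simp
    then have "coeff (pCons 0 ?G) j = 0" unfolding sh by (simp only: low) simp
    moreover have "coeff ([:1, 1:] ^ k * [:shift i, 1:]) (Suc (Suc 0)) = 0"
    proof -
      have "2 * (k choose 2) = k * (k - 1)" using times_binomial_minus1_eq[of 2 k] by simp
      then have "complex_of_nat (2 * (k choose 2)) = of_nat (k * (k - 1))" by (simp only:)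
      then have "2 * complex_of_nat (k choose 2) = of_nat k * (of_nat k - 1)"
        using kn by (simp add: of_nat_diff)
      moreover have "complex_of_nat k - 1 \<noteq> 0" using kn by auto
      ultimately show ?thesis
        unfolding coeff_one_plus_power_mult using ij
        by (simp add: shift_def numeral_2_eq_2 field_simps)
    qed
    moreover have "Suc n - j = Suc (Suc 0)" using ij n by simp
    ultimately show ?thesis by (simp only: probe_coeff[OF assms]) simp
  qed
  show "plane_coeff (probe i) v w (Suc n - i) i (\<lambda>A. p (base A)) \<noteq> 0"
  proof (cases "i = n")
    case False
    then have i: "i < n" "min i (n - 1) = i" using assms by auto
    have "i \<noteq> 0 \<Longrightarrow> i - 1 < min i (n - 1)" using i by arith
    then have "coeff (pCons 0 ?G) i = 0" unfolding sh using low[of "i - 1"] by presburger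
    moreover have "coeff ?G i = 1" using diag by (simp only: i(2))
    moreover have "coeff ([:1, 1:] ^ k * [:shift i, 1:] :: complex poly) (Suc n - i) = of_nat (k choose (n - i))"
      unfolding pow[OF assms] coeff_one_plus_power_mult using i by (simp add: shift_def)
    moreover have "k choose (n - i) \<noteq> 0" using kn by (simp add: binomial_eq_0_iff)
    ultimately show ?thesis by (simp only: probe_coeff[OF assms]) simp
  next
    case True
    have "coeff ?G n = 0"
    proof -
      have "?G = Polynomial.monom 1 (n - 1)" using True n by (simp add: min_def)
      then show ?thesis using n by simp
    qed
    moreover have "coeff (pCons 0 ?G) n = 1" unfolding sh using diag True n by simp
    ultimately have "plane_coeff (probe i) v w (Suc n - i) n (\<lambda>A. p (base A)) = of_nat (k choose (Suc n - i))"
      by (simp only: probe_coeff[OF assms] coeff_one_plus_power) simp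
    then show ?thesis using True kn by simp
  qed
qed

subsection \<open>Failure of normality\<close>

lemma base_in_orbit: "(\<lambda>A. p (base A)) \<in> orbit"
  unfolding base_def by (intro act_square_zero offdiag_base_forms) simp

text \<open>Since q(v) = l(v)^k h(v), F equals (l(w)/l(v))^k q(v), and elimination supplies the
  ratio. Numerator and denominator carry a common factor \<open>?D\<close> that vanishes where l(v)
  = 0: it makes the identity hold at points where elimination gives nothing, and it ensures that a
  nonzero denominator implies l(v) nonzero.\<close>

lemma p_rational:
  obtains A C where "A \<in> poly_funs fscale Q" "C \<in> poly_funs fscale Q" "C (\<lambda>A. p (base A)) \<noteq> 0"
    "\<And>T. lin T \<Longrightarrow> A (\<lambda>x. p (T x)) = C (\<lambda>x. p (T x)) * (corner (T w) ^ k * per (T v))"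
    "\<And>T. lin T \<Longrightarrow> corner (T v) = 0 \<Longrightarrow> C (\<lambda>x. p (T x)) = 0"
proof -
  let ?M = "\<lambda>i j. plane_coeff (probe i) v w (Suc n - j) j"
  let ?q = "\<lambda>T x. p (T x)"
  have "\<exists>A\<in>poly_funs fscale Q. \<exists>B\<in>poly_funs fscale Q. B (?q base) \<noteq> 0 \<and>
    (\<forall>q \<nu>. (\<forall>i\<le>n. (\<Sum>j\<le>Suc n. ?M i j q * \<nu> j) = 0) \<longrightarrow> B q * \<nu> n = A q * \<nu> (Suc n))"
    by (rule triangular_elimination) (simp_all only: plane_coeff_poly_funs probe_triangular not_False_eq_True)
  then obtain A B where AB: "A \<in> poly_funs fscale Q" "B \<in> poly_funs fscale Q" "B (?q base) \<noteq> 0"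
    "\<And>q \<nu>. \<forall>i\<le>n. (\<Sum>j\<le>Suc n. ?M i j q * \<nu> j) = 0 \<Longrightarrow> B q * \<nu> n = A q * \<nu> (Suc n)"
    by blast
  let ?D = "plane_coeff v w 0 (n - 1) 0"
  have ev: "(\<lambda>q. q v) \<in> poly_funs fscale Q"
    by (intro poly_funs.linear) (simp add: linear_form_on_def fscale_def)
  have "(\<lambda>q. ?D q * (- A q) ^ k * q v) \<in> poly_funs fscale Q"
    by (intro poly_funs.mult poly_funs_power poly_funs_uminus AB plane_coeff_poly_funs ev)
  moreover have "(\<lambda>q. ?D q * B q ^ k) \<in> poly_funs fscale Q"
    by (intro poly_funs.mult poly_funs_power AB plane_coeff_poly_funs)
  moreover have "?D (?q base) * B (?q base) ^ k \<noteq> 0" using AB(3) by (simp only: base_low_coeff) simp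
  moreover have "?D (?q T) * (- A (?q T)) ^ k * ?q T v
      = ?D (?q T) * B (?q T) ^ k * (corner (T w) ^ k * per (T v))" if T: "lin T" for T
  proof (cases "corner (T v) = 0")
    case True
    show ?thesis by (simp only: p_low_coeff[OF T True]) simp
  next
    case False
    define a b where "a = corner (T v)" "b = corner (T w)"
    \<comment> \<open>The two monomials left by elimination are b (-a)^n and (-a)^(n+1); cancelling
      (-a)^n gives b/a.\<close>
    have "B (?q T) * (b ^ (Suc n - n) * (- a) ^ n) = A (?q T) * (b ^ (Suc n - Suc n) * (- a) ^ Suc n)"
      by (rule AB(4)[of "?q T" "\<lambda>j. b ^ (Suc n - j) * (- a) ^ j"])
         (use p_relation[OF T] in \<open>simp only: a_b_def simp_thms\<close>)
    then have eq: "(B (?q T) * b) * (- a) ^ n = (- A (?q T) * a) * (- a) ^ n" by (simp add: mult.assoc)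
    have "(- a) ^ n \<noteq> 0" using False by (simp add: a_b_def)
    from mult_right_cancel[OF this, THEN iffD1, OF eq]
    have "B (?q T) * b = - A (?q T) * a" .
    then have "B (?q T) ^ k * b ^ k = (- A (?q T)) ^ k * a ^ k"
      by (simp only: power_mult_distrib[symmetric])
    moreover have "?q T v = a ^ k * per (T v)" by (simp only: p_eq a_b_def)
    ultimately show ?thesis unfolding a_b_def(2)[symmetric] by (metis (no_types, lifting) mult.assoc)
  qed
  moreover have "?D (?q T) * B (?q T) ^ k = 0" if "lin T" "corner (T v) = 0" for T
    by (simp only: p_low_coeff[OF that]) simp
  ultimately show thesis by (rule that)
qed

text \<open>The regular function \<open>F\<close> is only determined where the denominator does not vanish; a segment
  from the base point reaches the degenerate forms \<open>\<phi>\<^sup>k \<psi>\<^sup>n\<close> by continuation.\<close>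

lemma regular_extension:
  assumes normal: "normal_variety fscale Q (orbit_closure p)"
  shows "\<exists>F\<in>poly_funs fscale Q. \<forall>\<phi> \<psi>. offdiag_form \<phi> \<longrightarrow> offdiag_form \<psi> \<longrightarrow>
    F (\<lambda>A. \<phi> A ^ k * \<psi> A ^ n) = \<phi> w ^ k * \<psi> v ^ n"
proof -
  let ?q = "\<lambda>T x. p (T x)"
  obtain A C where AC: "A \<in> poly_funs fscale Q" "C \<in> poly_funs fscale Q" "C (?q base) \<noteq> 0"
    and A: "\<And>T. lin T \<Longrightarrow> A (?q T) = C (?q T) * (corner (T w) ^ k * per (T v))"
    and C0: "\<And>T. lin T \<Longrightarrow> corner (T v) = 0 \<Longrightarrow> C (?q T) = 0"
    using p_rational by blast
  obtain P d where P: "coeffs_in fscale Q P" "\<And>q. monic_upto d 1 (P q)"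
    "\<And>T. lin T \<Longrightarrow> corner (T v) \<noteq> 0 \<Longrightarrow> poly (P (?q T)) (corner (T w) ^ k * per (T v)) = 0"
    using p_integral by metis
  have "\<exists>F\<in>poly_funs fscale Q. \<forall>q\<in>orbit. A q = F q * C q"
  proof (rule integrally_closed_coordinate_ring_divides[where y = "?q base"])
    show "integrally_closed_domain (coordinate_ring fscale Q (zariski_closure fscale Q orbit))"
      using normal by (simp add: normal_variety_def orbit_closure_def card[symmetric])
    show "(\<lambda>q. coeff (P q) i) \<in> poly_funs fscale Q" for i using P(1) by (simp add: coeffs_in_def)
    show "coeff (P q) d = 1" for q using P(2) by (simp add: monic_upto_def)
    show "coeff (P q) i = 0" if "i > d" for q i using P(2)[of q] that by (simp add: monic_upto_def)
    show "\<exists>w. C q * w = A q \<and> (C q \<noteq> 0 \<longrightarrow> poly (P q) w = 0)" if q: "q \<in> orbit" for q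
    proof -
      obtain T where T: "lin T" "q = ?q T" using orbit_cases[OF q] by blast
      \<comment> \<open>The witness is F itself. A nonzero denominator forces l(v) to be nonzero,
        which is when the integral equation is available.\<close>
      show ?thesis
        using A[OF T(1)] C0[OF T(1)] P(3)[OF T(1)] unfolding T(2) by metis
    qed
  qed (fact orbit_subset_Q AC base_in_orbit)+
  then obtain F where F: "F \<in> poly_funs fscale Q" "\<And>q. q \<in> orbit \<Longrightarrow> A q = F q * C q" by blast
  have "F (\<lambda>A. \<phi> A ^ k * \<psi> A ^ n) = \<phi> w ^ k * \<psi> v ^ n"
    if \<phi>: "offdiag_form \<phi>" and \<psi>: "offdiag_form \<psi>" for \<phi> \<psi>
  proof -
    define \<Lambda> where "\<Lambda> i = (if i = e 1 then \<phi> else \<psi>)" for i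
    \<comment> \<open>The direction from \<open>base\<close> to \<open>diag_map \<Lambda>\<close>.
      The scalar part of \<open>T t\<close> is 1 - t, so every t other than 1 gives a point of the
      orbit, and at t = 1 only the diagonal map remains.\<close>
    define Y where "Y A = mscale (- 1) A + diag_map (\<lambda>i x. \<Lambda> i x + (- 1) * base_forms i x) A" for A
    have \<Lambda>: "offdiag_form (\<Lambda> i)" for i using \<phi> \<psi> by (simp add: \<Lambda>_def)
    have "lin Y" unfolding Y_def[abs_def]
      by (intro linear_diag_map offdiag_form_add offdiag_form_scale \<Lambda> offdiag_base_forms)
    define T where "T t A = base A + mscale t (Y A)" for t A
    define q where "q t = (\<lambda>A. p (T t A))" for t
    have lin: "lin (T t)" for t
      using lin_base \<open>lin Y\<close> by (simp add: T_def[abs_def] linear_mscale_iff vec_eq_iff algebra_simps)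
    have T_eq: "T t A = mscale (1 - t) A + diag_map (\<lambda>i x. (1 - t) * base_forms i x + t * \<Lambda> i x) A" for t A
      by (simp add: T_def base_def Y_def vec_eq_iff algebra_simps)
    have q_curve: "q \<in> poly_curves m"
      unfolding q_def[abs_def] T_def[abs_def] by (rule p_curve[OF lin_base \<open>lin Y\<close>])
    obtain rC rF where r: "\<And>t. C (q t) = poly rC t" "\<And>t. F (q t) = poly rF t"
      using poly_fun_on_poly_curve[OF AC(2) q_curve] poly_fun_on_poly_curve[OF F(1) q_curve] by blast
    obtain H where "\<And>t. poly H t = permanent_on B (\<lambda>i j. base v $ e i $ e j + t * Y v $ e i $ e j)"
      by (rule permanent_on_line[where I = B and M = "\<lambda>i j. base v $ e i $ e j"
            and N = "\<lambda>i j. Y v $ e i $ e j"]) (rule finite_atLeastAtMost, rule that, simp)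
    then have H: "per (T t v) = poly H t" for t by (simp add: T_def)
    define R where "R = [:corner (base w), corner (Y w):] ^ k * H"
    have R: "corner (T t w) ^ k * per (T t v) = poly R t" for t
      unfolding H by (simp add: R_def T_def)
    \<comment> \<open>The denominator is nonzero at t = 0, so it can be cancelled as a polynomial in
      t; the value at t = 1 follows even if the denominator vanishes there.\<close>
    have "rC * (rF - R) = 0"
    proof (rule poly_zero_off_point_imp_zero)
      fix t :: complex assume "t \<noteq> 1"
      then have "q t \<in> orbit"
        unfolding q_def T_eq
        by (intro act_square_zero offdiag_form_add offdiag_form_scale \<Lambda> offdiag_base_forms) simp
      from F(2)[OF this] have "C (q t) * poly R t = F (q t) * C (q t)"
        using A[OF lin[of t]] by (simp only: R q_def)
      then show "poly (rC * (rF - R)) t = 0" by (auto simp: r)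
    qed
    moreover have "rC \<noteq> 0"
    proof
      assume "rC = 0"
      moreover have "T 0 = base" by (simp add: T_def fun_eq_iff vec_eq_iff)
      ultimately show False using r(1)[of 0] AC(3) by (simp add: q_def)
    qed
    ultimately have "rF = R" by simp
    then have "F (q 1) = corner (T 1 w) ^ k * per (T 1 v)" by (simp only: r(2) R)
    moreover have "T 1 = (\<lambda>A. mscale 0 A + diag_map \<Lambda> A)" by (simp add: T_eq fun_eq_iff)
    moreover have "p (mscale 0 A + diag_map \<Lambda> A) = \<phi> A ^ k * \<psi> A ^ n" for A
    proof -
      have "(\<Prod>i\<in>B. \<Lambda> (e i) A) = (\<Prod>i\<in>B. \<psi> A)"
        using e_distinct(4) by (intro prod.cong) (auto simp: \<Lambda>_def)
      then have "(\<Prod>i\<in>B. \<Lambda> (e i) A) = \<psi> A ^ n" by (simp only: prod_constant card_B)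
      then show ?thesis by (subst p_diag_map) (simp_all add: \<Lambda>_def)
    qed
    moreover have "corner (mscale 0 w + diag_map \<Lambda> w) = \<phi> w" by (simp add: \<Lambda>_def)
    moreover have "per (mscale 0 v + diag_map \<Lambda> v) = \<psi> v ^ n"
    proof -
      have "per (mscale 0 v + diag_map \<Lambda> v) = (\<Prod>i\<in>B. (mscale 0 v + diag_map \<Lambda> v) $ e i $ e i)"
        by (intro permanent_on_diagonal) (auto simp: e_eq)
      also have "\<dots> = (\<Prod>i\<in>B. \<psi> v)"
        using e_distinct(4) by (intro prod.cong) (auto simp: \<Lambda>_def)
      finally show ?thesis by (simp only: prod_constant card_B)
    qed
    ultimately show ?thesis by (simp only: q_def)
  qed
  with F(1) show ?thesis by blast
qed

lemma not_normal: "\<not> normal_variety fscale Q (orbit_closure p)"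
proof
  assume "normal_variety fscale Q (orbit_closure p)"
  then obtain F where F: "F \<in> poly_funs fscale Q"
    "\<And>\<phi> \<psi>. offdiag_form \<phi> \<Longrightarrow> offdiag_form \<psi> \<Longrightarrow> F (\<lambda>A. \<phi> A ^ k * \<psi> A ^ n) = \<phi> w ^ k * \<psi> v ^ n"
    using regular_extension by blast
  have entry_in: "(\<lambda>A :: complex^'m^'m. A $ i $ j) \<in> homog_polys 1" for i j by (rule homog_polys_entry)
  obtain c L where L: "linear_form_on fscale Q L"
    "\<And>q. q \<in> Q \<Longrightarrow> \<exists>r. \<forall>t. F (fscale t q) = c + t * L q + t\<^sup>2 * poly r t"
    using linear_part[OF F(1)] by blast
  have L_eq: "L (\<lambda>A. \<phi> A ^ k * \<psi> A ^ n) = \<phi> w ^ k * \<psi> v ^ n"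
    if \<phi>: "offdiag_form \<phi>" "offdiag_form \<psi>" and q: "(\<lambda>A. \<phi> A ^ k * \<psi> A ^ n) \<in> Q" for \<phi> \<psi>
  proof -
    let ?q = "\<lambda>A. \<phi> A ^ k * \<psi> A ^ n"
    obtain r where r: "\<And>t. F (fscale t ?q) = c + t * L ?q + t\<^sup>2 * poly r t" using L(2)[OF q] by blast
    have "[:c, L ?q - \<phi> w ^ k * \<psi> v ^ n:] + [:0, 0, 1:] * r = 0"
    proof (rule poly_zero_off_point_imp_zero)
      fix t :: complex assume "t \<noteq> 0"
      \<comment> \<open>An n-th root of t is absorbed into \<open>\<psi>\<close>, so t times the
        product has the same shape and F is homogeneous along this ray. Comparing with the expansion
        at the origin identifies the value of F with that of \<open>L\<close>.\<close>
      define s where "s = exp (Ln t / of_nat n)"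
      have s: "s ^ n = t"
        using \<open>t \<noteq> 0\<close> n by (simp add: s_def flip: exp_of_nat_mult)
      have "F (\<lambda>A. \<phi> A ^ k * (s * \<psi> A) ^ n) = \<phi> w ^ k * (s * \<psi> v) ^ n"
        by (intro F(2) offdiag_form_scale \<phi>)
      moreover have "(\<lambda>A. \<phi> A ^ k * (s * \<psi> A) ^ n) = fscale t ?q"
        by (simp add: fscale_def s power_mult_distrib mult_ac)
      ultimately have "F (fscale t ?q) = t * (\<phi> w ^ k * \<psi> v ^ n)"
        by (simp add: power_mult_distrib s)
      then show "poly ([:c, L ?q - \<phi> w ^ k * \<psi> v ^ n:] + [:0, 0, 1:] * r) t = 0"
        using r[of t] by (simp add: algebra_simps power2_eq_square)
    qed
    from arg_cong[OF this, of "\<lambda>r. coeff r 1"] show ?thesis by simp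
  qed
  let ?x = "\<lambda>A :: complex^'m^'m. A $ e 1 $ e 2" and ?y = "\<lambda>A :: complex^'m^'m. A $ e 1 $ e 3"
  have forms: "offdiag_form ?x" "offdiag_form ?y" using e_distinct by (simp_all add: offdiag_form_entry)
  have vals: "?x v = 1" "?y v = 0" "?x w = 0" "?y w = 1" using e_distinct by (simp_all add: v_def w_def)
  define u where "u i = (\<lambda>A. ?x A ^ i * ?y A ^ (m - i))" for i
  have u: "u i \<in> Q" if "i \<le> m" for i
  proof -
    have "u i \<in> homog_polys (i * 1 + (m - i) * 1)"
      unfolding u_def by (intro homog_polys_mult homog_polys_power entry_in)
    then show ?thesis using that by simp
  qed
  have "u n = (\<lambda>A. ?y A ^ k * ?x A ^ n)" using k by (simp add: u_def mult.commute)
  then have Lu: "L (u n) = 1"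
    using L_eq[OF forms(2,1)] u[of n] kn by (simp add: vals[simplified])
  have "L (\<lambda>A. \<Sum>i\<le>m. (of_nat (m choose i) * \<beta> ^ i) * u i A) = \<beta> ^ n" for \<beta>
  proof -
    let ?f = "\<lambda>A. \<beta> * ?x A + ?y A"
    have f: "offdiag_form ?f" by (intro offdiag_form_add offdiag_form_scale forms)
    have eq: "(\<lambda>A. \<Sum>i\<le>m. (of_nat (m choose i) * \<beta> ^ i) * u i A) = (\<lambda>A. ?f A ^ k * ?f A ^ n)"
      by (simp add: u_def binomial_ring[of _ _ m] kn(2) power_mult_distrib mult_ac flip: power_add)
    have "(\<lambda>A. \<Sum>i\<le>m. (of_nat (m choose i) * \<beta> ^ i) * u i A) \<in> Q"
      by (intro homog_polys_sum homog_polys_scale u) simp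
    then show ?thesis unfolding eq using L_eq[OF f f] by (simp add: vals[simplified])
  qed
  then have "(\<Sum>i\<le>m. (of_nat (m choose i) * \<beta> ^ i) * L (u i)) = \<beta> ^ n" for \<beta>
    using linear_form_sum[OF L(1), of "{..m}" u] u by simp
  then have "poly (\<Sum>i\<le>m. Polynomial.monom (of_nat (m choose i) * L (u i)) i) \<beta> = poly (Polynomial.monom 1 n) \<beta>" for \<beta>
    by (simp add: poly_sum poly_monom mult_ac)
  then have "(\<Sum>i\<le>m. Polynomial.monom (of_nat (m choose i) * L (u i)) i) = Polynomial.monom 1 n"
    by (simp add: poly_eq_poly_eq_iff[symmetric] fun_eq_iff)
  from arg_cong[OF this, of "\<lambda>r. coeff r n"] have "of_nat (m choose n) * L (u n) = 1"
    using kn by (simp add: coeff_sum sum.delta)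
  then have "m choose n = 1" using Lu by (simp only: mult_1_right of_nat_eq_1_iff)
  moreover have "m \<le> m choose n" using kn n by (intro upper_le_binomial) auto
  ultimately show False using kn n by simp
qed

end

theorem theorem8p4:
  fixes e :: "nat \<Rightarrow> 'm::finite" and m n :: nat
  assumes "m = CARD('m)"
    and "bij_betw e {1..m} UNIV"
    and "n \<ge> 3"
    and "m \<ge> 2 * n"
  shows "\<not> normal_variety fscale (homog_polys m) (orbit_closure (padded_perm e n))"
proof -
  interpret padded_permanent e m n "m - n" using assms by unfold_locales auto
  show ?thesis by (rule not_normal)
qed

end
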